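(* There is an algorithm that, for any $\varepsilon>0$ and any election instance, outputs a full solution $(A,w)$ which is a $(2+\varepsilon)$-approximation for the maximin support problem and whose committee $A$ satisfies PJR, and which executes in time $O(\mathrm{bal}\cdot|C|\cdot\log(1/\varepsilon))$.
   Context: An election instance consists of a finite bipartite graph $G=(N\cup C,E)$ with no isolated vertices ($N$ = voters, $C$ = candidates), a vector $s\in\mathbb{R}^N$ of non-negative vote strengths, and an integer $k$ with $0<k<|C|$. Write $nc$ for $\{n,c\}$, $C_n=\{c: nc\in E\}$, $N_c=\{n: nc\in E\}$. A weight vector $w\in\mathbb{R}^E$ is feasible if $w\ge0$ and $\sum_{c\in C_n}w_{nc}\le s_n$ for all $n$. $\mathrm{supp}_w(c)=\sum_{n\in N_c}w_{nc}$, $\mathrm{supp}_w(A)=\min_{c\in A}\mathrm{supp}_w(c)$. A full solution is $(A,w)$ with $A\subseteq C$, $|A|=k$, $w$ feasible. The maximin support problem maximizes $\mathrm{supp}_w(A)$ over full solutions; OPT is the optimal value; a full solution is an $\alpha$-approximation if $\mathrm{supp}_w(A)\ge\mathrm{OPT}/\alpha$. A feasible $w$ is balanced for $A$ if it maximizes $\sum_{c\in A}\mathrm{supp}_w(c)$ over feasible vectors and, among those, minimizes $\sum_{c\in A}\mathrm{supp}_w(c)^2$; $\mathrm{bal}$ denotes the time complexity of computing a balanced weight vector for a given committee. Numerical operations take constant time. A committee $A$ with $|A|=k$ satisfies PJR if there is no $N'\subseteq N$ and integer $0<r\le k$ with (a) $\sum_{n\in N'}s_n\ge\frac rk\sum_{n\in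 N}s_n$, (b) $|\bigcap_{n\in N'}C_n|\ge r$, (c) $|A\cap\bigcup_{n\in N'}C_n|<r$.
   Formalization: PJR is claimed only when the total vote strength is positive (with all strengths zero no committee may satisfy PJR), and since log(1/ε) vanishes or is negative for ε near or above 1, the time bound uses log(1/min(ε,1/2)); vertices are labelled by natural numbers. *)

theory Defs
  imports Complex_Main
begin

section \<open>Elections and the maximin support problem\<close>

record ('v, 'c) election =
  voters :: "'v set"
  cands :: "'c set"
  edges :: "('v \<times> 'c) set"
  strength :: "'v \<Rightarrow> real"
  seats :: nat

definition election_instance :: "('v, 'c) election \<Rightarrow> bool" where
  "election_instance I \<longleftrightarrow>
     finite (voters I) \<and> finite (cands I) \<and>
     edges I \<subseteq> voters I \<times> cands I \<and>
     (\<forall>n\<in>voters I. \<exists>c. (n, c) \<in> edges I) \<and>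
     (\<forall>c\<in>cands I. \<exists>n. (n, c) \<in> edges I) \<and>
     (\<forall>n\<in>voters I. 0 \<le> strength I n) \<and>
     0 < seats I \<and> seats I < card (cands I)"

definition cands_of :: "('v, 'c) election \<Rightarrow> 'v \<Rightarrow> 'c set" where
  "cands_of I n = {c. (n, c) \<in> edges I}"

definition voters_of :: "('v, 'c) election \<Rightarrow> 'c \<Rightarrow> 'v set" where
  "voters_of I c = {n. (n, c) \<in> edges I}"

text \<open>Weight vectors are functions on pairs; only their values on \<open>edges I\<close> matter.\<close>

definition feasible :: "('v, 'c) election \<Rightarrow> ('v \<times> 'c \<Rightarrow> real) \<Rightarrow> bool" where
  "feasible I w \<longleftrightarrow>
     (\<forall>e\<in>edges I. 0 \<le> w e) \<and>
     (\<forall>n\<in>voters I. (\<Sum>c\<in>cands_of I n. w (n, c)) \<le> strength I n)"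

definition supp :: "('v, 'c) election \<Rightarrow> ('v \<times> 'c \<Rightarrow> real) \<Rightarrow> 'c \<Rightarrow> real" where
  "supp I w c = (\<Sum>n\<in>voters_of I c. w (n, c))"

definition min_supp :: "('v, 'c) election \<Rightarrow> ('v \<times> 'c \<Rightarrow> real) \<Rightarrow> 'c set \<Rightarrow> real" where
  "min_supp I w A = Min (supp I w ` A)"

definition full_solution ::
    "('v, 'c) election \<Rightarrow> 'c set \<Rightarrow> ('v \<times> 'c \<Rightarrow> real) \<Rightarrow> bool" where
  "full_solution I A w \<longleftrightarrow> A \<subseteq> cands I \<and> card A = seats I \<and> feasible I w"

text \<open>The supremum is over a nonempty bounded set and is attained, so it is the optimal value.\<close>

definition opt :: "('v, 'c) election \<Rightarrow> real" where
  "opt I = Sup {min_supp I w A | A w. full_solution I A w}"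

definition approximation ::
    "real \<Rightarrow> ('v, 'c) election \<Rightarrow> 'c set \<Rightarrow> ('v \<times> 'c \<Rightarrow> real) \<Rightarrow> bool" where
  "approximation \<alpha> I A w \<longleftrightarrow> full_solution I A w \<and> min_supp I w A \<ge> opt I / \<alpha>"

definition balanced ::
    "('v, 'c) election \<Rightarrow> 'c set \<Rightarrow> ('v \<times> 'c \<Rightarrow> real) \<Rightarrow> bool" where
  "balanced I A w \<longleftrightarrow>
     is_arg_min (\<lambda>u. \<Sum>c\<in>A. (supp I u c)\<^sup>2)
       (is_arg_max (\<lambda>u. \<Sum>c\<in>A. supp I u c) (feasible I)) w"

definition PJR :: "('v, 'c) election \<Rightarrow> 'c set \<Rightarrow> bool" where
  "PJR I A \<longleftrightarrow>
     A \<subseteq> cands I \<and> card A = seats I \<and>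
     \<not> (\<exists>N' r. N' \<subseteq> voters I \<and> 0 < r \<and> r \<le> seats I \<and>
          (\<Sum>n\<in>N'. strength I n) \<ge> real r / real (seats I) * (\<Sum>n\<in>voters I. strength I n) \<and>
          card (\<Inter>n\<in>N'. cands_of I n) \<ge> r \<and>
          card (A \<inter> (\<Union>n\<in>N'. cands_of I n)) < r)"

text \<open>
  If all vote strengths vanish, the first condition on \<open>N'\<close> is void and there may be no
  committee with PJR at all; PJR can be guaranteed only when the total strength is positive.
\<close>

lemma PJR_unsatisfiable_without_votes:
  defines "I \<equiv> \<lparr>voters = {0, 1}, cands = {0, 1}, edges = {(0, 0), (1, 1)},
                strength = (\<lambda>_. 0), seats = 1\<rparr> :: (nat, nat) election"
  shows "election_instance I" and "\<not> PJR I A"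
proof -
  show "election_instance I"
    by (auto simp: election_instance_def I_def)
  show "\<not> PJR I A"
  proof
    assume PJR: "PJR I A"
    then have "A \<subseteq> {0, 1}" "card A = 1"
      by (auto simp: PJR_def I_def)
    then obtain n where n: "n \<in> {0, 1}" "n \<notin> A"
      by (metis card_1_singletonE insertCI singletonD zero_neq_one)
    have "cands_of I n = {n}"
      using n(1) by (auto simp: cands_of_def I_def)
    with n have "\<exists>N' r. N' \<subseteq> voters I \<and> 0 < r \<and> r \<le> seats I \<and>
          (\<Sum>n\<in>N'. strength I n) \<ge> real r / real (seats I) * (\<Sum>n\<in>voters I. strength I n) \<and>
          card (\<Inter>n\<in>N'. cands_of I n) \<ge> r \<and>
          card (A \<inter> (\<Union>n\<in>N'. cands_of I n)) < r"
      by (intro exI[of _ "{n}"] exI[of _ 1]) (auto simp: I_def)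
    with PJR show False
      unfolding PJR_def by blast
  qed
qed

section \<open>A real-number random access machine with a subroutine\<close>

text \<open>
  Memory consists of named arrays of natural numbers and named arrays of reals; a scalar is
  cell 0 of an array. There are no real constants other than those denoted by natural numbers
  and no conversion from reals to naturals.
\<close>

type_synonym name = string

record store =
  nats :: "name \<Rightarrow> nat \<Rightarrow> nat"
  reals :: "name \<Rightarrow> nat \<Rightarrow> real"

datatype nexp =
    NConst nat
  | NGet name nexp
  | NAdd nexp nexp
  | NSub nexp nexp

datatype rexp =
    RNat nexp
  | RGet name nexp
  | RAdd rexp rexp
  | RSub rexp rexp
  | RMul rexp rexp
  | RDiv rexp rexp

datatype bexp =
    NLess nexp nexp
  | RLess rexp rexp
  | BNot bexp
  | BAnd bexp bexp

datatype prog =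
    Skip
  | NSet name nexp nexp
  | RSet name nexp rexp
  | Seq prog prog
  | Cond bexp prog prog
  | While bexp prog
  | Call name name

fun nval :: "nexp \<Rightarrow> store \<Rightarrow> nat" where
  "nval (NConst m) s = m"
| "nval (NGet x i) s = nats s x (nval i s)"
| "nval (NAdd a b) s = nval a s + nval b s"
| "nval (NSub a b) s = nval a s - nval b s"

fun rval :: "rexp \<Rightarrow> store \<Rightarrow> real" where
  "rval (RNat a) s = real (nval a s)"
| "rval (RGet x i) s = reals s x (nval i s)"
| "rval (RAdd a b) s = rval a s + rval b s"
| "rval (RSub a b) s = rval a s - rval b s"
| "rval (RMul a b) s = rval a s * rval b s"
| "rval (RDiv a b) s = rval a s / rval b s"

fun bval :: "bexp \<Rightarrow> store \<Rightarrow> bool" where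
  "bval (NLess a b) s \<longleftrightarrow> nval a s < nval b s"
| "bval (RLess a b) s \<longleftrightarrow> rval a s < rval b s"
| "bval (BNot a) s \<longleftrightarrow> \<not> bval a s"
| "bval (BAnd a b) s \<longleftrightarrow> bval a s \<and> bval b s"

definition nupd :: "name \<Rightarrow> nat \<Rightarrow> nat \<Rightarrow> store \<Rightarrow> store" where
  "nupd x i v s = s\<lparr>nats := (nats s)(x := (nats s x)(i := v))\<rparr>"

definition rupd :: "name \<Rightarrow> nat \<Rightarrow> real \<Rightarrow> store \<Rightarrow> store" where
  "rupd x i v s = s\<lparr>reals := (reals s)(x := (reals s x)(i := v))\<rparr>"

text \<open>
  \<open>exec f p s t s'\<close>: program \<open>p\<close> started in \<open>s\<close> halts in \<open>s'\<close> after \<open>t\<close> time units.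
  Every assignment and every test takes one time unit; the expressions evaluated in such a step
  are part of the fixed program text, so this counts numerical operations up to a factor that
  depends on the program only. \<open>Call x y\<close> runs the subroutine \<open>f\<close> on the array of naturals \<open>x\<close>
  and stores its result in the array of reals \<open>y\<close>; the second component of \<open>f\<close> is the time
  this takes.
\<close>

inductive exec ::
    "((nat \<Rightarrow> nat) \<Rightarrow> (nat \<Rightarrow> real) \<times> nat) \<Rightarrow> prog \<Rightarrow> store \<Rightarrow> nat \<Rightarrow> store \<Rightarrow> bool"
  for f where
  Skip: "exec f Skip s 1 s"
| NSet: "exec f (NSet x i a) s 1 (nupd x (nval i s) (nval a s) s)"
| RSet: "exec f (RSet x i a) s 1 (rupd x (nval i s) (rval a s) s)"
| Seq: "exec f p s t s' \<Longrightarrow> exec f q s' u s'' \<Longrightarrow> exec f (Seq p q) s (t + u) s''"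
| CondT: "bval b s \<Longrightarrow> exec f p s t s' \<Longrightarrow> exec f (Cond b p q) s (1 + t) s'"
| CondF: "\<not> bval b s \<Longrightarrow> exec f q s t s' \<Longrightarrow> exec f (Cond b p q) s (1 + t) s'"
| WhileF: "\<not> bval b s \<Longrightarrow> exec f (While b p) s 1 s"
| WhileT: "bval b s \<Longrightarrow> exec f p s t s' \<Longrightarrow> exec f (While b p) s' u s'' \<Longrightarrow>
    exec f (While b p) s (1 + t + u) s''"
| Call: "f (nats s x) = (r, t) \<Longrightarrow> exec f (Call x y) s t (s\<lparr>reals := (reals s)(y := r)\<rparr>)"

lemma exec_deterministic:
  "exec f p s t s' \<Longrightarrow> exec f p s u s'' \<Longrightarrow> t = u \<and> s' = s''"
proof (induction arbitrary: u s'' rule: exec.induct)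
  case (Skip s)
  then show ?case by (auto elim: exec.cases)
next
  case (NSet x i a s)
  then show ?case by (auto elim: exec.cases)
next
  case (RSet x i a s)
  then show ?case by (auto elim: exec.cases)
next
  case (Seq p s t s1 q v s2)
  from Seq.prems show ?case
    by cases (use Seq.IH in blast)
next
  case (CondT b s p t s' q)
  from CondT.prems show ?case
    by cases (use CondT in blast)+
next
  case (CondF b s q t s' p)
  from CondF.prems show ?case
    by cases (use CondF in blast)+
next
  case (WhileF b s p)
  from WhileF.prems show ?case
    by cases (use WhileF in auto)
next
  case (WhileT b s p t s1 v s2)
  from WhileT.prems show ?case
    by cases (use WhileT in blast)+
next
  case (Call s x r t y)
  from Call.prems show ?case
    by cases (use Call in auto)
qed

section \<open>Input, output and the balancing subroutine\<close>

text \<open>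
  An instance is presented as an edge list: voters, candidates and edges are numbered by
  duplicate-free lists \<open>vs\<close>, \<open>cs\<close>, \<open>es\<close>, and the machine only sees the numbers.
\<close>

definition enumerates ::
    "('v, 'c) election \<Rightarrow> 'v list \<Rightarrow> 'c list \<Rightarrow> ('v \<times> 'c) list \<Rightarrow> bool" where
  "enumerates I vs cs es \<longleftrightarrow>
     distinct vs \<and> set vs = voters I \<and>
     distinct cs \<and> set cs = cands I \<and>
     distinct es \<and> set es = edges I"

text \<open>The contents of all cells not mentioned here are arbitrary.\<close>

definition input_store ::
    "('v, 'c) election \<Rightarrow> 'v list \<Rightarrow> 'c list \<Rightarrow> ('v \<times> 'c) list \<Rightarrow> real \<Rightarrow> store \<Rightarrow> bool" where
  "input_store I vs cs es \<epsilon> s \<longleftrightarrow>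
     nats s ''numvoters'' 0 = length vs \<and>
     nats s ''numcands'' 0 = length cs \<and>
     nats s ''numedges'' 0 = length es \<and>
     nats s ''seats'' 0 = seats I \<and>
     (\<forall>j<length es.
        nats s ''voter'' j < length vs \<and> nats s ''cand'' j < length cs \<and>
        es ! j = (vs ! nats s ''voter'' j, cs ! nats s ''cand'' j)) \<and>
     (\<forall>i<length vs. reals s ''strength'' i = strength I (vs ! i)) \<and>
     reals s ''eps'' 0 = \<epsilon>"

definition decode_cands :: "'c list \<Rightarrow> (nat \<Rightarrow> nat) \<Rightarrow> 'c set" where
  "decode_cands cs a = {cs ! i | i. i < length cs \<and> a i \<noteq> 0}"

definition output_store ::
    "'c list \<Rightarrow> ('v \<times> 'c) list \<Rightarrow> 'c set \<Rightarrow> ('v \<times> 'c \<Rightarrow> real) \<Rightarrow> store \<Rightarrow> bool" where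
  "output_store cs es A w s \<longleftrightarrow>
     A = decode_cands cs (nats s ''committee'') \<and>
     (\<forall>j<length es. w (es ! j) = reals s ''weight'' j)"

text \<open>
  A procedure that finds the weight vector \<open>solve A\<close> for the committee \<open>A\<close> in \<open>time A\<close> steps and
  then writes out its entries, one step per edge.
\<close>

definition subroutine ::
    "'c list \<Rightarrow> ('v \<times> 'c) list \<Rightarrow> ('c set \<Rightarrow> 'v \<times> 'c \<Rightarrow> real) \<Rightarrow> ('c set \<Rightarrow> nat) \<Rightarrow>
     (nat \<Rightarrow> nat) \<Rightarrow> (nat \<Rightarrow> real) \<times> nat" where
  "subroutine cs es solve time a =
     (let A = decode_cands cs a
      in (\<lambda>j. if j < length es then solve A (es ! j) else 0, time A + length es))"

text \<open>
  \<open>bal\<close> bounds the time of every call; committees under construction have at most \<open>seats I\<close>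
  members, and nothing is assumed about calls on larger sets.
\<close>

definition balancing_procedure ::
    "('v, 'c) election \<Rightarrow> ('c set \<Rightarrow> 'v \<times> 'c \<Rightarrow> real) \<Rightarrow> ('c set \<Rightarrow> nat) \<Rightarrow> real \<Rightarrow> bool" where
  "balancing_procedure I solve time bal \<longleftrightarrow>
     (\<forall>A. A \<subseteq> cands I \<and> card A \<le> seats I \<longrightarrow>
        balanced I A (solve A) \<and> real (time A + card (edges I)) \<le> bal)"

end

theory Submission
  imports Defs
begin

text \<open>
  A committee \<open>A\<close> admits a feasible weight vector giving every member support at least \<open>t\<close> iff
  \<open>s(N(X)) - t |X| \<ge> 0\<close> for all \<open>X \<subseteq> A\<close> (Hall's condition), and then every balanced vector is such a
  vector; so one call of the balancing procedure decides this condition on \<open>t\<close>.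

  Scan the candidates once, adding \<open>c\<close> to \<open>A\<close> whenever \<open>A + c\<close> still satisfies the condition, until
  \<open>A\<close> has \<open>k\<close> members. If the scan ends with fewer, submodularity of \<open>X \<mapsto> s(N(X)) - t |X|\<close> shows that
  no committee of size \<open>k\<close> has value \<open>2 t\<close>. A bisection over \<open>t\<close> therefore yields factor \<open>2 + \<epsilon>\<close>,
  with \<open>O(log (1/\<epsilon>))\<close> scans once the optimum is known up to a constant factor. That factor (4) comes
  from \<open>k\<close> greedy steps in the manner of Phragmen, each using a single balanced vector.

  For PJR, every scan and the greedy phase start from the same set, the outcome of a scan with
  threshold \<open>S/k\<close>, where \<open>S\<close> is the total strength: a candidate witnessing a violation of PJR for
  any superset of it could have been added to it.
\<close>

section \<open>Preliminaries\<close>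

lemma sum_UN_le:
  fixes f :: "'a \<Rightarrow> 'b :: ordered_comm_monoid_add"
  assumes "finite D" "\<And>c. c \<in> D \<Longrightarrow> finite (F c)" "\<And>c x. c \<in> D \<Longrightarrow> x \<in> F c \<Longrightarrow> 0 \<le> f x"
  shows "sum f (\<Union>c\<in>D. F c) \<le> (\<Sum>c\<in>D. sum f (F c))"
  using assms
proof (induction D rule: finite_induct)
  case (insert c D)
  let ?rest = "(\<Union>c\<in>D. F c) - F c"
  have "sum f (\<Union>c\<in>insert c D. F c) = sum f (F c) + sum f ?rest"
    using insert by (subst sum.union_disjoint[symmetric]) auto
  also have "sum f ?rest \<le> sum f (\<Union>c\<in>D. F c)"
    using insert by (intro sum_mono2) auto
  also have "\<dots> \<le> (\<Sum>c\<in>D. sum f (F c))"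
    using insert by blast
  finally show ?case using insert.hyps by (simp add: add_left_mono)
qed simp

lemma sum_less_Suc_if:
  fixes v :: "nat \<Rightarrow> 'a :: comm_monoid_add"
  shows "(\<Sum>j | j < Suc m \<and> P j. v j) = (\<Sum>j | j < m \<and> P j. v j) + (if P m then v m else 0)"
proof -
  have "{j. j < Suc m \<and> P j} = (if P m then insert m else id) {j. j < m \<and> P j}"
    by (auto simp: less_Suc_eq)
  then show ?thesis by (auto simp: add.commute)
qed

lemma sum_nth_filter:
  assumes "distinct xs"
  shows "(\<Sum>j | j < length xs \<and> P (xs ! j). g (xs ! j)) = (\<Sum>x | x \<in> set xs \<and> P x. g x)"
  using assms
  by (intro sum.reindex_cong[symmetric, where l = "nth xs"])
    (auto simp: inj_on_def nth_eq_iff_index_eq in_set_conv_nth)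

lemma sum_nth_key:
  assumes "distinct xs" "distinct ys" "i < length xs"
    and "\<And>j. j < length ys \<Longrightarrow> key j < length xs \<and> p (ys ! j) = xs ! key j"
  shows "(\<Sum>j | j < length ys \<and> key j = i. g (ys ! j)) = (\<Sum>y | y \<in> set ys \<and> p y = xs ! i. g y)"
proof -
  have "key j = i \<longleftrightarrow> p (ys ! j) = xs ! i" if "j < length ys" for j
    using assms(4)[OF that] assms(1,3) by (simp add: nth_eq_iff_index_eq)
  then have "(\<Sum>j | j < length ys \<and> key j = i. g (ys ! j))
      = (\<Sum>j | j < length ys \<and> p (ys ! j) = xs ! i. g (ys ! j))"
    by (intro sum.cong) auto
  then show ?thesis using sum_nth_filter[OF assms(2), where P = "\<lambda>y. p y = xs ! i"] by simp
qed

lemma card_less_exchange: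
  assumes "finite A" "finite B" "X \<subseteq> A" "card A < card B"
  shows "card X < card (X \<inter> B \<union> (B - A))"
proof -
  have "card X = card (X \<inter> B) + card (X - B)"
    using assms by (metis card_Int_Diff finite_subset)
  also have "card (X - B) \<le> card (A - B)"
    using assms by (intro card_mono) auto
  also have "card (A - B) < card (B - A)"
    using assms by (intro card_less_sym_Diff)
  also have "card (X \<inter> B) + card (B - A) = card (X \<inter> B \<union> (B - A))"
    using assms by (intro card_Un_disjoint[symmetric]) auto
  finally show ?thesis by simp
qed

lemma exists_power_two_ge:
  fixes x :: real
  assumes "1 \<le> x"
  shows "\<exists>n. x \<le> 2 ^ n \<and> real n \<le> log 2 x + 1"
proof -
  define n where "n = nat \<lceil>log 2 x\<rceil>"
  have "0 \<le> log 2 x" using assms by simp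
  then have n_bounds: "log 2 x \<le> real n" "real n \<le> log 2 x + 1"
    unfolding n_def by linarith+
  have "x = 2 powr log 2 x" using assms by simp
  also have "\<dots> \<le> 2 powr real n" using n_bounds(1) by simp
  also have "\<dots> = 2 ^ n" by (simp add: powr_realpow)
  finally show ?thesis using n_bounds(2) by blast
qed

section \<open>The Hall condition\<close>

definition nbrs :: "('v, 'c) election \<Rightarrow> 'c set \<Rightarrow> 'v set" where
  "nbrs I X = (\<Union>c\<in>X. voters_of I c)"

definition slack :: "('v, 'c) election \<Rightarrow> real \<Rightarrow> 'c set \<Rightarrow> real" where
  "slack I t X = sum (strength I) (nbrs I X) - t * real (card X)"

definition hall :: "('v, 'c) election \<Rightarrow> real \<Rightarrow> 'c set \<Rightarrow> bool" where
  "hall I t A \<longleftrightarrow> (\<forall>X\<subseteq>A. 0 \<le> slack I t X)"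

lemma nbrs_mono: "X \<subseteq> Y \<Longrightarrow> nbrs I X \<subseteq> nbrs I Y"
  unfolding nbrs_def by blast

lemma nbrs_Un: "nbrs I (X \<union> Y) = nbrs I X \<union> nbrs I Y"
  unfolding nbrs_def by blast

lemma slack_nonneg: "hall I t A \<Longrightarrow> X \<subseteq> A \<Longrightarrow> 0 \<le> slack I t X"
  unfolding hall_def by blast

lemma hallD: "hall I t A \<Longrightarrow> X \<subseteq> A \<Longrightarrow> t * real (card X) \<le> sum (strength I) (nbrs I X)"
  using slack_nonneg[of I t A X] by (simp add: slack_def)

lemma hall_empty: "hall I t {}"
  by (simp add: hall_def slack_def nbrs_def)

lemma hall_subset: "hall I t A \<Longrightarrow> B \<subseteq> A \<Longrightarrow> hall I t B"
  unfolding hall_def by blast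

lemma hall_antimono: "hall I t A \<Longrightarrow> t' \<le> t \<Longrightarrow> hall I t' A"
  unfolding hall_def slack_def by (smt (verit) mult_right_mono of_nat_0_le_iff)

lemma hall_insert_violation:
  assumes "hall I t A" "\<not> hall I t (insert c A)"
  obtains X where "c \<in> X" "X \<subseteq> insert c A" "slack I t X < 0"
  using assms unfolding hall_def by (metis not_le subset_insert)

section \<open>Weight vectors of an election\<close>

locale valid_election =
  fixes I :: "('v, 'c) election"
  assumes election_instance: "election_instance I"
begin

lemma finite_voters: "finite (voters I)"
  and finite_cands: "finite (cands I)"
  and edges_subset: "edges I \<subseteq> voters I \<times> cands I"
  and strength_nonneg: "n \<in> voters I \<Longrightarrow> 0 \<le> strength I n"
  and seats_pos: "0 < seats I"
  and seats_less: "seats I < card (cands I)"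
  using election_instance unfolding election_instance_def by auto

lemma finite_edges: "finite (edges I)"
  using edges_subset finite_voters finite_cands finite_subset by blast

lemma finite_if_subset_cands: "A \<subseteq> cands I \<Longrightarrow> finite A"
  using finite_cands finite_subset by blast

lemma voters_of_subset: "voters_of I c \<subseteq> voters I"
  and cands_of_subset: "cands_of I n \<subseteq> cands I"
  and nbrs_subset: "nbrs I X \<subseteq> voters I"
  using edges_subset unfolding voters_of_def cands_of_def nbrs_def by auto

lemma finite_voters_of: "finite (voters_of I c)"
  and finite_cands_of: "finite (cands_of I n)"
  and finite_nbrs: "finite (nbrs I X)"
  using voters_of_subset cands_of_subset nbrs_subset finite_voters finite_cands finite_subset
  by metis+

lemma card_cands_le_card_edges: "card (cands I) \<le> card (edges I)"
  and card_voters_le_card_edges: "card (voters I) \<le> card (edges I)"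
proof -
  have "cands I \<subseteq> snd ` edges I" "voters I \<subseteq> fst ` edges I"
    using election_instance unfolding election_instance_def by force+
  then show "card (cands I) \<le> card (edges I)" "card (voters I) \<le> card (edges I)"
    using finite_edges by (meson card_image_le card_mono finite_imageI order_trans)+
qed

lemma sum_edges_of_cand:
  "(\<Sum>e | e \<in> edges I \<and> snd e = c. g e) = (\<Sum>n\<in>voters_of I c. g (n, c))"
  by (intro sum.reindex_cong[where l = "\<lambda>n. (n, c)"])
    (auto simp: inj_on_def voters_of_def image_iff)

lemma sum_edges_of_voter:
  "(\<Sum>e | e \<in> edges I \<and> fst e = n. g e) = (\<Sum>c\<in>cands_of I n. g (n, c))"
  by (intro sum.reindex_cong[where l = "\<lambda>c. (n, c)"])
    (auto simp: inj_on_def cands_of_def image_iff)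

lemma sum_strength_mono:
  "M \<subseteq> N \<Longrightarrow> N \<subseteq> voters I \<Longrightarrow> sum (strength I) M \<le> sum (strength I) N"
  using strength_nonneg finite_voters by (intro sum_mono2) (auto intro: finite_subset)

lemma sum_strength_Un_Int:
  assumes "M \<subseteq> voters I" "N \<subseteq> voters I"
  shows "sum (strength I) (M \<union> N) + sum (strength I) (M \<inter> N)
    = sum (strength I) M + sum (strength I) N"
  using assms finite_voters by (intro sum.union_inter) (auto intro: finite_subset)

lemma hall_nonpos: "t \<le> 0 \<Longrightarrow> hall I t A"
  unfolding hall_def slack_def using nbrs_subset strength_nonneg
  by (auto intro!: sum_nonneg order_trans[OF mult_nonpos_nonneg])

lemma sum_supp:
  assumes "X \<subseteq> cands I"
  shows "(\<Sum>c\<in>X. supp I w c) = (\<Sum>n\<in>nbrs I X. \<Sum>c\<in>cands_of I n \<inter> X. w (n, c))"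
proof -
  have "(\<Sum>c\<in>X. supp I w c) = (\<Sum>c\<in>X. \<Sum>n | n \<in> nbrs I X \<and> (n, c) \<in> edges I. w (n, c))"
    unfolding supp_def by (intro sum.cong refl) (auto simp: nbrs_def voters_of_def)
  also have "\<dots> = (\<Sum>n\<in>nbrs I X. \<Sum>c | c \<in> X \<and> (n, c) \<in> edges I. w (n, c))"
    using finite_if_subset_cands[OF assms] finite_nbrs by (intro sum.swap_restrict)
  also have "\<dots> = (\<Sum>n\<in>nbrs I X. \<Sum>c\<in>cands_of I n \<inter> X. w (n, c))"
    by (intro sum.cong refl) (auto simp: cands_of_def)
  finally show ?thesis .
qed

lemma feasible_nonneg: "feasible I w \<Longrightarrow> (n, c) \<in> edges I \<Longrightarrow> 0 \<le> w (n, c)"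
  unfolding feasible_def by blast

lemma supp_nonneg: "feasible I w \<Longrightarrow> 0 \<le> supp I w c"
  unfolding supp_def voters_of_def by (intro sum_nonneg) (auto intro: feasible_nonneg)

lemma feasible_sum_le:
  assumes "feasible I w" "n \<in> voters I"
  shows "(\<Sum>c\<in>cands_of I n \<inter> X. w (n, c)) \<le> strength I n"
proof -
  have "(\<Sum>c\<in>cands_of I n \<inter> X. w (n, c)) \<le> (\<Sum>c\<in>cands_of I n. w (n, c))"
    using assms(1) finite_cands_of
    by (intro sum_mono2) (auto simp: cands_of_def intro: feasible_nonneg)
  with assms show ?thesis unfolding feasible_def by force
qed

lemma hall_if_supp_ge:
  assumes "feasible I w" "A \<subseteq> cands I" "\<And>c. c \<in> A \<Longrightarrow> t \<le> supp I w c"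
  shows "hall I t A"
  unfolding hall_def
proof (intro allI impI)
  fix X assume X_subset: "X \<subseteq> A"
  have "t * real (card X) = (\<Sum>c\<in>X. t)" by simp
  also have "\<dots> \<le> (\<Sum>c\<in>X. supp I w c)"
    using X_subset assms(3) by (intro sum_mono) auto
  also have "\<dots> = (\<Sum>n\<in>nbrs I X. \<Sum>c\<in>cands_of I n \<inter> X. w (n, c))"
    using X_subset assms(2) by (intro sum_supp) auto
  also have "\<dots> \<le> sum (strength I) (nbrs I X)"
    using assms(1) nbrs_subset by (intro sum_mono feasible_sum_le) auto
  finally show "0 \<le> slack I t X" by (simp add: slack_def)
qed

section \<open>Balanced weight vectors\<close>

lemma balanced_feasible: "balanced I A w \<Longrightarrow> feasible I w"
  unfolding balanced_def is_arg_min_def is_arg_max_def by blast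

lemma balanced_sum_supp_ge:
  "balanced I A w \<Longrightarrow> feasible I u \<Longrightarrow> (\<Sum>c\<in>A. supp I u c) \<le> (\<Sum>c\<in>A. supp I w c)"
  unfolding balanced_def is_arg_min_def is_arg_max_linorder by blast

lemma balanced_sum_squares_le:
  assumes "balanced I A w" "feasible I u" "(\<Sum>c\<in>A. supp I u c) = (\<Sum>c\<in>A. supp I w c)"
  shows "(\<Sum>c\<in>A. (supp I w c)\<^sup>2) \<le> (\<Sum>c\<in>A. (supp I u c)\<^sup>2)"
  using assms unfolding balanced_def is_arg_min_linorder is_arg_max_linorder by simp

definition shift :: "'v \<Rightarrow> ('c \<Rightarrow> real) \<Rightarrow> ('v \<times> 'c \<Rightarrow> real) \<Rightarrow> 'v \<times> 'c \<Rightarrow> real" where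
  "shift n g w = (\<lambda>(m, c). w (m, c) + (if m = n then g c else 0))"

lemma supp_shift:
  "supp I (shift n g w) c = supp I w c + (if (n, c) \<in> edges I then g c else 0)"
  unfolding supp_def shift_def using finite_voters_of[of c]
  by (simp add: sum.distrib voters_of_def)

lemma feasible_shift:
  assumes "feasible I w" "\<And>c. (n, c) \<in> edges I \<Longrightarrow> 0 \<le> w (n, c) + g c"
    and "(\<Sum>c\<in>cands_of I n. w (n, c)) + (\<Sum>c\<in>cands_of I n. g c) \<le> strength I n"
  shows "feasible I (shift n g w)"
  unfolding feasible_def
proof (intro conjI ballI)
  show "0 \<le> shift n g w e" if "e \<in> edges I" for e
    using assms(1,2) that unfolding shift_def feasible_def by (cases e) auto
  show "(\<Sum>c\<in>cands_of I m. shift n g w (m, c)) \<le> strength I m" if "m \<in> voters I" for m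
    using assms(1,3) that by (cases "m = n") (auto simp: shift_def sum.distrib feasible_def)
qed

lemma balanced_spends_all:
  assumes balanced: "balanced I A w" and A_subset: "A \<subseteq> cands I"
    and c_edge: "c \<in> A" "(n, c) \<in> edges I"
  shows "(\<Sum>d\<in>cands_of I n \<inter> A. w (n, d)) = strength I n"
proof (rule ccontr)
  assume not_spent: "\<not> ?thesis"
  have feasible: "feasible I w" using balanced by (rule balanced_feasible)
  define rest where "rest = strength I n - (\<Sum>d\<in>cands_of I n \<inter> A. w (n, d))"
  have rest_pos: "0 < rest"
    using feasible_sum_le[OF feasible, of n A] not_spent c_edge(2) edges_subset unfolding rest_def
    by fastforce
  define g where "g d = (if d \<in> A then 0 else - w (n, d)) + (if d = c then rest else 0)" for d
  have "(\<Sum>d\<in>cands_of I n. w (n, d)) + (\<Sum>d\<in>cands_of I n. g d)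
      = (\<Sum>d\<in>cands_of I n. (if d \<in> A then w (n, d) else 0) + (if d = c then rest else 0))"
    unfolding sum.distrib[symmetric] by (intro sum.cong) (auto simp: g_def)
  also have "\<dots> = strength I n"
    using c_edge finite_cands_of[of n]
    by (simp add: sum.distrib rest_def cands_of_def flip: sum.inter_restrict)
  finally have "feasible I (shift n g w)"
    using feasible rest_pos
    by (intro feasible_shift) (auto simp: g_def intro!: add_nonneg_nonneg intro: feasible_nonneg)
  moreover have "(\<Sum>d\<in>A. supp I (shift n g w) d) = (\<Sum>d\<in>A. supp I w d + (if d = c then rest else 0))"
    using c_edge by (intro sum.cong) (auto simp: supp_shift g_def)
  then have "(\<Sum>d\<in>A. supp I (shift n g w) d) = (\<Sum>d\<in>A. supp I w d) + rest"
    using c_edge finite_if_subset_cands[OF A_subset] by (simp add: sum.distrib)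
  ultimately show False using balanced_sum_supp_ge[OF balanced] rest_pos by fastforce
qed

lemma balanced_spends_on_least:
  assumes balanced: "balanced I A w" and A_subset: "A \<subseteq> cands I"
    and c_edge: "c \<in> A" "(n, c) \<in> edges I" and d_edge: "d \<in> A" "(n, d) \<in> edges I"
    and spends: "w (n, c) \<noteq> 0"
  shows "supp I w c \<le> supp I w d"
proof (rule ccontr)
  assume not_least: "\<not> ?thesis"
  then have "c \<noteq> d" by auto
  have feasible: "feasible I w" using balanced by (rule balanced_feasible)
  obtain \<delta> where \<delta>_bounds: "0 < \<delta>" "\<delta> \<le> w (n, c)" "\<delta> < supp I w c - supp I w d"
  proof
    let ?\<delta> = "min (w (n, c)) ((supp I w c - supp I w d) / 2)"
    show "0 < ?\<delta>" "?\<delta> \<le> w (n, c)" "?\<delta> < supp I w c - supp I w d"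
      using not_least spends feasible_nonneg[OF feasible c_edge(2)]
      by (auto simp: min_less_iff_disj)
  qed
  define g where "g x = (if x = c then - \<delta> else 0) + (if x = d then \<delta> else 0)" for x
  define u where "u = shift n g w"
  have "sum g (cands_of I n) = 0"
    using finite_cands_of c_edge(2) d_edge(2) by (simp add: g_def sum.distrib cands_of_def)
  then have feasible_u: "feasible I u"
    unfolding u_def
    using feasible \<delta>_bounds feasible_sum_le[OF feasible, of n UNIV] c_edge(2) edges_subset
    by (intro feasible_shift) (auto simp: g_def intro: feasible_nonneg add_nonneg_nonneg)
  have supp_u: "supp I u x = supp I w x + g x" for x
    using c_edge d_edge by (auto simp: u_def supp_shift g_def)
  have split: "(\<Sum>x\<in>A. f x) = (\<Sum>x\<in>A - {c, d}. f x) + (f c + f d)" for f :: "'c \<Rightarrow> real"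
    using sum.subset_diff[of "{c, d}" A f] c_edge d_edge finite_if_subset_cands[OF A_subset] \<open>c \<noteq> d\<close>
    by simp
  have supp_u_c: "supp I u c = supp I w c - \<delta>" and supp_u_d: "supp I u d = supp I w d + \<delta>"
    using \<open>c \<noteq> d\<close> by (auto simp: supp_u g_def)
  have others: "(\<Sum>x\<in>A - {c, d}. f (supp I u x)) = (\<Sum>x\<in>A - {c, d}. f (supp I w x))"
    for f :: "real \<Rightarrow> real"
    by (intro sum.cong) (auto simp: supp_u g_def)
  have "(\<Sum>x\<in>A. (supp I w x)\<^sup>2) \<le> (\<Sum>x\<in>A. (supp I u x)\<^sup>2)"
    using balanced feasible_u
    by (rule balanced_sum_squares_le) (simp add: split others[of "\<lambda>x. x"] supp_u_c supp_u_d)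
  then have "(supp I w c)\<^sup>2 + (supp I w d)\<^sup>2 \<le> (supp I w c - \<delta>)\<^sup>2 + (supp I w d + \<delta>)\<^sup>2"
    by (simp add: split others[of power2] supp_u_c supp_u_d)
  then have "0 \<le> \<delta> * (supp I w d + \<delta> - supp I w c)"
    by (simp add: power2_eq_square algebra_simps)
  with \<delta>_bounds show False by (simp add: zero_le_mult_iff)
qed

text \<open>A voter approving a member of support at most \<open>t\<close> spends everything on such members.\<close>

lemma strength_nbrs_low_supp:
  fixes t :: real
  assumes balanced: "balanced I A w" and A_subset: "A \<subseteq> cands I"
  defines "L \<equiv> {c \<in> A. supp I w c \<le> t}"
  shows "sum (strength I) (nbrs I L) = (\<Sum>c\<in>L. supp I w c)"
proof -
  have "(\<Sum>c\<in>cands_of I n \<inter> L. w (n, c)) = strength I n" if n_nbr: "n \<in> nbrs I L" for n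
  proof -
    from n_nbr obtain c where c_low: "c \<in> A" "supp I w c \<le> t" "(n, c) \<in> edges I"
      by (auto simp: nbrs_def L_def voters_of_def)
    have "w (n, d) = 0" if d_not_low: "d \<in> cands_of I n \<inter> A - cands_of I n \<inter> L" for d
      using balanced_spends_on_least[OF balanced A_subset, of d n c] d_not_low c_low
      by (force simp: cands_of_def L_def)
    then have "(\<Sum>c\<in>cands_of I n \<inter> A. w (n, c)) = (\<Sum>c\<in>cands_of I n \<inter> L. w (n, c))"
      using finite_cands_of by (intro sum.mono_neutral_right) (auto simp: L_def)
    with balanced_spends_all[OF balanced A_subset c_low(1,3)] show ?thesis by simp
  qed
  moreover have "L \<subseteq> cands I" using A_subset by (auto simp: L_def)
  ultimately show ?thesis by (simp add: sum_supp)
qed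

lemma balanced_supp_ge:
  assumes balanced: "balanced I A w" and A_subset: "A \<subseteq> cands I" and hall: "hall I t A"
    and c_member: "c \<in> A"
  shows "t \<le> supp I w c"
proof -
  have finite_supps: "finite (supp I w ` A)" using finite_if_subset_cands[OF A_subset] by simp
  define m where "m = Min (supp I w ` A)"
  define L where "L = {c \<in> A. supp I w c \<le> m}"
  have "m \<in> supp I w ` A" unfolding m_def using finite_supps c_member by (intro Min_in) auto
  then have "0 < card L"
    using finite_if_subset_cands[OF A_subset] by (auto simp: L_def card_gt_0_iff)
  have "t * real (card L) \<le> sum (strength I) (nbrs I L)"
    using hallD[OF hall] by (simp add: L_def)
  also have "\<dots> = (\<Sum>c\<in>L. supp I w c)"
    unfolding L_def by (rule strength_nbrs_low_supp[OF balanced A_subset])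
  also have "\<dots> \<le> (\<Sum>c\<in>L. m)" by (intro sum_mono) (simp add: L_def)
  finally have "t \<le> m" using \<open>0 < card L\<close> by (simp add: mult.commute)
  also have "m \<le> supp I w c" using finite_supps c_member by (simp add: m_def)
  finally show ?thesis .
qed

lemma hall_iff_balanced_supp_ge:
  assumes "balanced I A w" "A \<subseteq> cands I"
  shows "hall I t A \<longleftrightarrow> (\<forall>c\<in>A. t \<le> supp I w c)"
  using assms balanced_supp_ge hall_if_supp_ge balanced_feasible by metis

section \<open>Committees and their values\<close>

definition committee :: "'c set \<Rightarrow> bool" where
  "committee A \<longleftrightarrow> A \<subseteq> cands I \<and> card A = seats I"

definition attainable :: "real \<Rightarrow> bool" where
  "attainable t \<longleftrightarrow> (\<exists>A. committee A \<and> hall I t A)"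

definition quota :: real where
  "quota = sum (strength I) (voters I) / real (seats I)"

lemma quota_nonneg: "0 \<le> quota"
  unfolding quota_def using strength_nonneg by (simp add: sum_nonneg)

lemma quota_mult_seats: "quota * real (seats I) = sum (strength I) (voters I)"
  using seats_pos by (simp add: quota_def)

lemma attainable_le_quota:
  assumes "attainable t"
  shows "t \<le> quota"
proof -
  from assms obtain B where B_committee: "card B = seats I" "hall I t B"
    unfolding attainable_def committee_def by blast
  have "t * real (seats I) \<le> sum (strength I) (nbrs I B)"
    using hallD[OF B_committee(2)] B_committee(1) by fastforce
  also have "\<dots> \<le> quota * real (seats I)"
    unfolding quota_mult_seats using nbrs_subset by (intro sum_strength_mono) auto
  finally show ?thesis using seats_pos by simp
qed

lemma attainable_min_supp:
  assumes "full_solution I A w"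
  shows "attainable (min_supp I w A)"
proof -
  have A_committee: "A \<subseteq> cands I" "card A = seats I" and feasible: "feasible I w"
    using assms by (auto simp: full_solution_def)
  have "hall I (min_supp I w A) A"
    using feasible A_committee(1) finite_if_subset_cands[OF A_committee(1)]
    by (intro hall_if_supp_ge) (auto simp: min_supp_def)
  with A_committee show ?thesis unfolding attainable_def committee_def by blast
qed

lemma opt_le:
  assumes "full_solution I A w" "\<And>v. attainable v \<Longrightarrow> v \<le> b"
  shows "opt I \<le> b"
  unfolding opt_def
proof (rule cSup_least)
  show "{min_supp I w A |A w. full_solution I A w} \<noteq> {}" using assms(1) by blast
qed (use assms(2) attainable_min_supp in blast)

section \<open>Saturated sets\<close>

definition saturated :: "'c set \<Rightarrow> real \<Rightarrow> 'c set \<Rightarrow> bool" where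
  "saturated C t A \<longleftrightarrow> A \<subseteq> cands I \<and> card A \<le> seats I \<and> hall I t A \<and>
     (card A = seats I \<or> (\<forall>c\<in>C - A. \<not> hall I t (insert c A)))"

lemma saturated_empty:
  "A \<subseteq> cands I \<Longrightarrow> card A \<le> seats I \<Longrightarrow> hall I t A \<Longrightarrow> saturated {} t A"
  by (simp add: saturated_def)

lemma saturated_skip:
  assumes "saturated C t A" "c \<in> A \<or> card A = seats I \<or> \<not> hall I t (insert c A)"
  shows "saturated (insert c C) t A"
  using assms by (auto simp: saturated_def)

lemma saturated_add:
  assumes "saturated C t A" "c \<in> cands I - A" "card A < seats I" "hall I t (insert c A)"
  shows "saturated (insert c C) t (insert c A)"
proof -
  have "\<not> hall I t (insert d (insert c A))" if "d \<in> C - A" for d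
    using assms(1,3) that hall_subset[of I t "insert d (insert c A)" "insert d A"]
    by (auto simp: saturated_def)
  with assms show ?thesis
    using finite_if_subset_cands[of A] by (auto simp: saturated_def)
qed

lemma slack_submodular:
  assumes "finite X" "finite Y"
  shows "slack I t (X \<union> Y) + slack I t (X \<inter> Y) \<le> slack I t X + slack I t Y"
proof -
  have "sum (strength I) (nbrs I (X \<union> Y)) + sum (strength I) (nbrs I (X \<inter> Y))
      \<le> sum (strength I) (nbrs I X \<union> nbrs I Y) + sum (strength I) (nbrs I X \<inter> nbrs I Y)"
    unfolding nbrs_Un using nbrs_subset
    by (intro add_left_mono sum_strength_mono) (auto simp: nbrs_def)
  also have "\<dots> = sum (strength I) (nbrs I X) + sum (strength I) (nbrs I Y)"
    using nbrs_subset by (intro sum_strength_Un_Int)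
  moreover have "t * real (card (X \<union> Y)) + t * real (card (X \<inter> Y))
      = t * real (card X) + t * real (card Y)"
    using card_Un_Int[OF assms] by (metis distrib_left of_nat_add)
  ultimately show ?thesis by (simp add: slack_def)
qed

text \<open>Submodularity adds up the violations for the single candidates of \<open>D\<close> to one for all of \<open>D\<close>.\<close>

lemma hall_extension_violation:
  assumes hall: "hall I t A" and A_subset: "A \<subseteq> cands I"
    and D_blocked: "finite D" "D \<noteq> {}" "D \<inter> A = {}" "\<And>c. c \<in> D \<Longrightarrow> \<not> hall I t (insert c A)"
  shows "\<exists>Y\<subseteq>A. slack I t (Y \<union> D) < 0"
  using D_blocked
proof (induction D rule: finite_ne_induct)
  case (singleton c)
  then obtain X where X_violates: "c \<in> X" "X \<subseteq> insert c A" "slack I t X < 0"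
    using hall_insert_violation[OF hall] by (metis insertI1)
  then have "(X - {c}) \<union> {c} = X" "X - {c} \<subseteq> A" by auto
  with X_violates show ?case by metis
next
  case (insert c D)
  then obtain Y where Y_violates: "Y \<subseteq> A" "slack I t (Y \<union> D) < 0" by auto
  obtain X where X_violates: "c \<in> X" "X \<subseteq> insert c A" "slack I t X < 0"
    using hall_insert_violation[OF hall] insert.prems(2) by (metis insertI1)
  have finite_sets: "finite (Y \<union> D)" "finite X"
    using X_violates(2) Y_violates(1) insert.hyps finite_if_subset_cands[OF A_subset] finite_subset
    by auto
  have "(Y \<union> D) \<inter> X \<subseteq> A"
    using X_violates(2) Y_violates(1) insert.hyps insert.prems by auto
  then have "0 \<le> slack I t ((Y \<union> D) \<inter> X)" by (rule slack_nonneg[OF hall])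
  then have "slack I t ((Y \<union> D) \<union> X) < 0"
    using slack_submodular[OF finite_sets, of t] Y_violates(2) X_violates(3) by linarith
  moreover have "(Y \<union> D) \<union> X = (Y \<union> (X - {c})) \<union> insert c D" using X_violates(1) by auto
  moreover have "Y \<union> (X - {c}) \<subseteq> A" using X_violates(2) Y_violates(1) by auto
  ultimately show ?case by metis
qed

lemma attainable_less_twice:
  assumes saturated: "saturated (cands I) t A" and not_full: "card A < seats I"
    and t_nonneg: "0 \<le> t" and v_attainable: "attainable v"
  shows "v < 2 * t"
proof (rule ccontr)
  assume "\<not> v < 2 * t"
  with v_attainable obtain B where B_committee: "B \<subseteq> cands I" "card B = seats I"
    and hallB: "hall I (2 * t) B"
    unfolding attainable_def committee_def using hall_antimono not_less by metis
  have A_subset: "A \<subseteq> cands I" and hallA: "hall I t A"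
    and maximal: "\<And>c. c \<in> cands I - A \<Longrightarrow> \<not> hall I t (insert c A)"
    using saturated not_full by (auto simp: saturated_def)
  have finite_sets: "finite A" "finite B"
    using A_subset B_committee(1) finite_if_subset_cands by blast+
  have "B - A \<noteq> {}"
    using not_full B_committee(2) finite_sets by (metis Diff_eq_empty_iff card_mono not_le)
  then obtain Y where Y_violates: "Y \<subseteq> A" "slack I t (Y \<union> (B - A)) < 0"
    using hall_extension_violation[OF hallA A_subset, of "B - A"] maximal B_committee(1) finite_sets
    by auto
  let ?Z = "Y \<inter> B \<union> (B - A)"
  have "card Y < card ?Z"
    using card_less_exchange[OF finite_sets Y_violates(1)] not_full B_committee(2) by simp
  moreover have "card (B - A) \<le> card ?Z" using finite_sets by (intro card_mono) auto
  ultimately have card_le: "card (Y \<union> (B - A)) \<le> 2 * card ?Z"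
    using card_Un_le[of Y "B - A"] by linarith
  have "2 * t * real (card ?Z) \<le> sum (strength I) (nbrs I ?Z)"
    by (intro hallD[OF hallB]) auto
  also have "\<dots> \<le> sum (strength I) (nbrs I (Y \<union> (B - A)))"
    using nbrs_subset by (intro sum_strength_mono nbrs_mono) auto
  also have "\<dots> < t * real (card (Y \<union> (B - A)))"
    using Y_violates(2) by (simp add: slack_def)
  also have "\<dots> \<le> t * real (2 * card ?Z)"
    using card_le t_nonneg by (intro mult_left_mono) auto
  finally show False by simp
qed

section \<open>Proportional justified representation\<close>

lemma underrepresented_strength:
  assumes hall: "hall I t A" and X_subset: "X \<subseteq> A" "finite X" and t_nonneg: "0 \<le> t"
    and N'_large: "N' \<subseteq> voters I" "t * real r \<le> sum (strength I) N'"
    and unrep: "card (X \<inter> (\<Union>n\<in>N'. cands_of I n)) < r"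
  shows "t * real (card X + 1) \<le> sum (strength I) (nbrs I X \<union> N')"
proof -
  let ?Z = "X - (\<Union>n\<in>N'. cands_of I n)"
  have disjoint: "nbrs I ?Z \<inter> N' = {}"
    by (auto simp: nbrs_def voters_of_def cands_of_def)
  have "card X + 1 \<le> card ?Z + r"
    using unrep card_Int_Diff[OF X_subset(2), of "\<Union>n\<in>N'. cands_of I n"] by simp
  then have "t * real (card X + 1) \<le> t * real (card ?Z + r)"
    using t_nonneg by (intro mult_left_mono) auto
  also have "\<dots> = t * real (card ?Z) + t * real r" by (simp add: distrib_left)
  also have "\<dots> \<le> sum (strength I) (nbrs I ?Z) + sum (strength I) N'"
    using hallD[OF hall, of ?Z] X_subset(1) N'_large(2) by (intro add_mono) auto
  also have "\<dots> = sum (strength I) (nbrs I ?Z \<union> N')"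
    using sum_strength_Un_Int[OF nbrs_subset N'_large(1), of ?Z] disjoint by simp
  also have "\<dots> \<le> sum (strength I) (nbrs I X \<union> N')"
    using nbrs_subset N'_large(1) by (intro sum_strength_mono) (auto simp: nbrs_def)
  finally show ?thesis .
qed

lemma saturated_quota_represents:
  assumes quota_pos: "0 < quota"
    and saturated: "saturated (cands I) quota A0" and A_extends: "A0 \<subseteq> A" "finite A"
    and N'_large: "N' \<subseteq> voters I" "quota * real r \<le> sum (strength I) N'" and r_pos: "0 < r"
    and cohesive: "r \<le> card (\<Inter>n\<in>N'. cands_of I n)"
  shows "r \<le> card (A \<inter> (\<Union>n\<in>N'. cands_of I n))"
proof (rule ccontr)
  assume unrep: "\<not> ?thesis"
  have hall: "hall I quota A0" using saturated by (simp add: saturated_def)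
  have finite_A0: "finite A0" using A_extends finite_subset by blast
  have bound: "quota * real (card X + 1) \<le> sum (strength I) (nbrs I X \<union> N')"
    if X_subset: "X \<subseteq> A0" for X
  proof (rule underrepresented_strength[OF hall X_subset _ quota_nonneg N'_large])
    show "finite X" using X_subset finite_A0 finite_subset by blast
    have "card (X \<inter> (\<Union>n\<in>N'. cands_of I n)) \<le> card (A \<inter> (\<Union>n\<in>N'. cands_of I n))"
      using X_subset A_extends by (intro card_mono) auto
    with unrep show "card (X \<inter> (\<Union>n\<in>N'. cands_of I n)) < r" by simp
  qed
  have "N' \<noteq> {}" using N'_large(2) r_pos quota_pos by (auto simp: mult_le_0_iff)
  have "\<not> (\<Inter>n\<in>N'. cands_of I n) \<subseteq> A"
  proof
    assume "(\<Inter>n\<in>N'. cands_of I n) \<subseteq> A"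
    then have "card (\<Inter>n\<in>N'. cands_of I n) \<le> card (A \<inter> (\<Union>n\<in>N'. cands_of I n))"
      using A_extends(2) \<open>N' \<noteq> {}\<close> by (intro card_mono) auto
    with cohesive unrep show False by simp
  qed
  then obtain c where c_outside: "c \<notin> A" "\<And>n. n \<in> N' \<Longrightarrow> c \<in> cands_of I n" by blast
  have "sum (strength I) (nbrs I A0 \<union> N') \<le> quota * real (seats I)"
    unfolding quota_mult_seats using nbrs_subset N'_large(1) by (intro sum_strength_mono) auto
  then have "card A0 \<noteq> seats I" using bound[of A0] quota_pos by (auto simp: distrib_left)
  moreover have "c \<in> cands I - A0" using c_outside \<open>N' \<noteq> {}\<close> cands_of_subset A_extends(1) by blast
  ultimately have "\<not> hall I quota (insert c A0)" using saturated by (simp add: saturated_def)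
  then obtain X where X_violates: "c \<in> X" "X \<subseteq> insert c A0" "slack I quota X < 0"
    using hall_insert_violation[OF hall] by metis
  have "card X = card (X - {c}) + 1"
    using X_violates(1,2) finite_A0 by (metis Suc_eq_plus1 card.remove finite_insert finite_subset)
  then have "quota * real (card X) \<le> sum (strength I) (nbrs I (X - {c}) \<union> N')"
    using bound[of "X - {c}"] X_violates(2) by auto
  also have "\<dots> \<le> sum (strength I) (nbrs I X)"
    using nbrs_subset X_violates(1) c_outside(2)
    by (intro sum_strength_mono) (auto simp: nbrs_def voters_of_def cands_of_def)
  finally show False using X_violates(3) by (simp add: slack_def)
qed

lemma PJR_if_saturated_quota:
  assumes votes_pos: "0 < sum (strength I) (voters I)"
    and saturated: "saturated (cands I) quota A0" and A_extends: "A0 \<subseteq> A" "committee A"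
  shows "PJR I A"
  unfolding PJR_def
proof (intro conjI notI)
  show A_subset: "A \<subseteq> cands I" and "card A = seats I"
    using A_extends(2) by (auto simp: committee_def)
  assume "\<exists>N' r. N' \<subseteq> voters I \<and> 0 < r \<and> r \<le> seats I \<and>
    real r / real (seats I) * sum (strength I) (voters I) \<le> sum (strength I) N' \<and>
    r \<le> card (\<Inter>n\<in>N'. cands_of I n) \<and> card (A \<inter> (\<Union>n\<in>N'. cands_of I n)) < r"
  then obtain N' r where "N' \<subseteq> voters I" "0 < r" "quota * real r \<le> sum (strength I) N'"
    "r \<le> card (\<Inter>n\<in>N'. cands_of I n)" and unrep: "card (A \<inter> (\<Union>n\<in>N'. cands_of I n)) < r"
    by (auto simp: quota_def mult.commute)
  moreover have "0 < quota" using votes_pos seats_pos by (simp add: quota_def)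
  ultimately have "r \<le> card (A \<inter> (\<Union>n\<in>N'. cands_of I n))"
    using saturated A_extends(1) finite_if_subset_cands[OF A_subset]
    by (intro saturated_quota_represents)
  with unrep show False by simp
qed

section \<open>Scores and greedy extensions\<close>

text \<open>
  If all supports in \<open>A\<close> are scaled down to \<open>t\<close>, voter \<open>n\<close> still spends \<open>t * load n\<close>; the score of
  \<open>c\<close> is the \<open>t\<close> for which the strength thereby freed among the approvers of \<open>c\<close> is exactly \<open>t\<close>.
\<close>

definition load :: "'c set \<Rightarrow> ('v \<times> 'c \<Rightarrow> real) \<Rightarrow> 'v \<Rightarrow> real" where
  "load A w n = (\<Sum>c\<in>cands_of I n \<inter> A. w (n, c) / supp I w c)"

definition score :: "'c set \<Rightarrow> ('v \<times> 'c \<Rightarrow> real) \<Rightarrow> 'c \<Rightarrow> real" where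
  "score A w c = (\<Sum>n\<in>voters_of I c. strength I n) / (1 + (\<Sum>n\<in>voters_of I c. load A w n))"

lemma load_nonneg: "feasible I w \<Longrightarrow> 0 \<le> load A w n"
  unfolding load_def using supp_nonneg
  by (intro sum_nonneg divide_nonneg_nonneg) (auto simp: cands_of_def intro: feasible_nonneg)

lemma le_score_iff:
  assumes "feasible I w"
  shows "t \<le> score A w c \<longleftrightarrow> t \<le> (\<Sum>n\<in>voters_of I c. strength I n - t * load A w n)"
proof -
  have "0 < 1 + (\<Sum>n\<in>voters_of I c. load A w n)"
    using load_nonneg[OF assms] by (intro add_pos_nonneg sum_nonneg) auto
  then show ?thesis
    by (simp add: score_def pos_le_divide_eq sum_subtractf sum_distrib_left[symmetric]
      algebra_simps)
qed

lemma load_le: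
  assumes "feasible I w" "n \<in> voters I" "0 < t" "\<And>c. c \<in> cands_of I n \<inter> A \<Longrightarrow> t \<le> supp I w c"
  shows "t * load A w n \<le> strength I n"
proof -
  have "t * load A w n = (\<Sum>c\<in>cands_of I n \<inter> A. w (n, c) * (t / supp I w c))"
    unfolding load_def sum_distrib_left by (simp add: mult_ac)
  also have "\<dots> \<le> (\<Sum>c\<in>cands_of I n \<inter> A. w (n, c))"
    using assms by (intro sum_mono mult_left_le) (force simp: feasible_def cands_of_def)+
  also have "\<dots> \<le> strength I n" using assms by (intro feasible_sum_le)
  finally show ?thesis .
qed

lemma hall_insert_if_score_ge:
  assumes feasible: "feasible I w" and A_subset: "A \<subseteq> cands I" and c_outside: "c \<in> cands I - A"
    and t_pos: "0 < t" and supp_ge: "\<And>d. d \<in> A \<Longrightarrow> t \<le> supp I w d"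
    and score: "t \<le> score A w c"
  shows "hall I t (insert c A)"
proof (rule hall_if_supp_ge)
  define u where "u = (\<lambda>(n, d). t * (if d \<in> A then w (n, d) / supp I w d else 0) +
    (if d = c then strength I n - t * load A w n else 0))"
  have load: "t * load A w n \<le> strength I n" if "n \<in> voters I" for n
    using load_le[OF feasible that t_pos] supp_ge by blast
  show "feasible I u"
    unfolding feasible_def
  proof (intro conjI ballI)
    fix e assume "e \<in> edges I"
    then show "0 \<le> u e"
      using load feasible t_pos edges_subset supp_nonneg[OF feasible] feasible_nonneg[OF feasible]
      by (auto simp: u_def intro!: add_nonneg_nonneg)
  next
    fix n assume n_voter: "n \<in> voters I"
    have "(\<Sum>d\<in>cands_of I n. u (n, d)) = t * load A w n +
        (if c \<in> cands_of I n then strength I n - t * load A w n else 0)"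
      using finite_cands_of
      by (simp add: u_def load_def sum.distrib sum_distrib_left sum.inter_restrict)
    then show "(\<Sum>d\<in>cands_of I n. u (n, d)) \<le> strength I n" using load[OF n_voter] by simp
  qed
  show "insert c A \<subseteq> cands I" using A_subset c_outside by simp
  show "t \<le> supp I u d" if "d \<in> insert c A" for d
  proof (cases "d = c")
    case True
    then have "supp I u d = (\<Sum>n\<in>voters_of I c. strength I n - t * load A w n)"
      using c_outside by (simp add: supp_def u_def)
    then show ?thesis using score le_score_iff[OF feasible] by simp
  next
    case False
    then have d_member: "d \<in> A" using that by simp
    have "supp I u d = (\<Sum>n\<in>voters_of I d. t * (w (n, d) / supp I w d))"
      unfolding supp_def[of I u] using False d_member by (simp add: u_def)
    also have "\<dots> = t * (supp I w d / supp I w d)"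
      by (simp add: supp_def flip: sum_distrib_left sum_divide_distrib)
    finally show ?thesis using supp_ge[OF d_member] t_pos by simp
  qed
qed

lemma strength_outside_low_nbrs_less:
  assumes feasible: "feasible I w" and t_pos: "0 < t" and supp_ge: "\<And>d. d \<in> A \<Longrightarrow> t \<le> supp I w d"
    and score: "score A w c < t"
  shows "sum (strength I) (voters_of I c - nbrs I {d \<in> A. supp I w d \<le> 2 * t}) < 2 * t"
proof -
  let ?far = "voters_of I c - nbrs I {d \<in> A. supp I w d \<le> 2 * t}"
  have "strength I n / 2 \<le> strength I n - t * load A w n" if "n \<in> ?far" for n
  proof -
    have "(2 * t) * load A w n \<le> strength I n"
      using that voters_of_subset t_pos
      by (intro load_le[OF feasible]) (force simp: nbrs_def cands_of_def voters_of_def)+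
    then show ?thesis by simp
  qed
  then have "(\<Sum>n\<in>?far. strength I n / 2) \<le> (\<Sum>n\<in>?far. strength I n - t * load A w n)"
    by (intro sum_mono)
  also have "\<dots> \<le> (\<Sum>n\<in>voters_of I c. strength I n - t * load A w n)"
    using load_le[OF feasible _ t_pos, of _ A] supp_ge finite_voters_of voters_of_subset[of c]
    by (intro sum_mono2) auto
  also have "\<dots> < t" using score le_score_iff[OF feasible] not_le by metis
  finally show ?thesis by (simp add: sum_divide_distrib[symmetric])
qed

lemma exists_score_ge:
  assumes balanced: "balanced I A w" and A_not_full: "A \<subseteq> cands I" "card A < seats I"
    and t_pos: "0 < t" and hall: "hall I t A" and attainable: "attainable (4 * t)"
  shows "\<exists>c\<in>cands I - A. t \<le> score A w c"
proof (rule ccontr)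
  assume contra: "\<not> ?thesis"
  from attainable obtain B where B_committee: "B \<subseteq> cands I" "card B = seats I"
    and hallB: "hall I (4 * t) B"
    unfolding attainable_def committee_def by blast
  have finite_sets: "finite A" "finite B"
    using A_not_full(1) B_committee(1) finite_if_subset_cands by blast+
  define L where "L = {c \<in> A. supp I w c \<le> 2 * t}"
  define Y where "Y = L \<inter> B \<union> (B - A)"
  let ?outside = "\<Union>c\<in>B - A. voters_of I c - nbrs I L"
  have outside_le: "sum (strength I) (voters_of I c - nbrs I L) \<le> 2 * t" if "c \<in> B - A" for c
    unfolding L_def using that contra B_committee(1) t_pos
    by (intro less_imp_le strength_outside_low_nbrs_less[OF balanced_feasible[OF balanced]]
        balanced_supp_ge[OF balanced A_not_full(1) hall]) force+
  have "4 * t * real (card Y) \<le> sum (strength I) (nbrs I Y)"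
    using hallD[OF hallB, of Y] by (auto simp: Y_def)
  also have "\<dots> \<le> sum (strength I) (nbrs I L \<union> ?outside)"
    using nbrs_subset voters_of_subset
    by (intro sum_strength_mono) (auto simp: nbrs_def Y_def)
  also have "\<dots> = sum (strength I) (nbrs I L) + sum (strength I) ?outside"
    using finite_nbrs finite_voters_of finite_sets by (intro sum.union_disjoint) auto
  also have "sum (strength I) ?outside \<le> (\<Sum>c\<in>B - A. sum (strength I) (voters_of I c - nbrs I L))"
    using finite_sets strength_nonneg voters_of_subset finite_voters_of by (intro sum_UN_le) auto
  also have "\<dots> \<le> (\<Sum>c\<in>B - A. 2 * t)" using outside_le by (intro sum_mono)
  also have "sum (strength I) (nbrs I L) \<le> (\<Sum>c\<in>L. 2 * t)"
    unfolding L_def strength_nbrs_low_supp[OF balanced A_not_full(1)] by (intro sum_mono) auto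
  finally have "2 * t * real (2 * card Y) \<le> 2 * t * real (card L + card (B - A))"
    by (simp add: algebra_simps)
  then have "2 * card Y \<le> card L + card (B - A)"
    using t_pos by (simp only: mult_le_cancel_left_pos of_nat_le_iff)
  moreover have "card L < card Y"
    unfolding Y_def
    using A_not_full(2) B_committee(2) finite_sets by (intro card_less_exchange) (auto simp: L_def)
  moreover have "card (B - A) \<le> card Y"
    using finite_sets by (intro card_mono) (auto simp: Y_def L_def)
  ultimately show False by linarith
qed

definition quarter_optimal :: "'c set \<Rightarrow> 'c set \<Rightarrow> bool" where
  "quarter_optimal A0 A \<longleftrightarrow> A0 \<subseteq> A \<and> (\<forall>t. attainable (4 * t) \<longrightarrow> hall I t A0 \<longrightarrow> hall I t A)"

lemma quarter_optimal_refl: "quarter_optimal A A"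
  by (simp add: quarter_optimal_def)

lemma quarter_optimal_insert:
  assumes quarter: "quarter_optimal A0 A" and balanced: "balanced I A w"
    and A_not_full: "A \<subseteq> cands I" "card A < seats I"
    and best: "is_arg_max (score A w) (\<lambda>c. c \<in> cands I - A) c"
  shows "quarter_optimal A0 (insert c A)"
  unfolding quarter_optimal_def
proof (intro conjI allI impI)
  show "A0 \<subseteq> insert c A" using quarter by (auto simp: quarter_optimal_def)
  fix t assume attainable: "attainable (4 * t)" and "hall I t A0"
  then have hall: "hall I t A" using quarter by (simp add: quarter_optimal_def)
  show "hall I t (insert c A)"
  proof (cases "0 < t")
    case True
    then obtain d where "d \<in> cands I - A" "t \<le> score A w d"
      using exists_score_ge[OF balanced A_not_full _ hall attainable] by blast
    then have "c \<in> cands I - A" "t \<le> score A w c"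
      using best unfolding is_arg_max_linorder by (blast, meson order_trans)
    then show ?thesis
      using True balanced_supp_ge[OF balanced A_not_full(1) hall]
      by (intro hall_insert_if_score_ge[OF balanced_feasible[OF balanced] A_not_full(1)])
  qed (simp add: hall_nonpos)
qed

section \<open>Bracketing the optimum\<close>

definition bracket :: "'c set \<Rightarrow> 'c set \<Rightarrow> real \<Rightarrow> real \<Rightarrow> bool" where
  "bracket A0 A l u \<longleftrightarrow> saturated (cands I) quota A0 \<and> A0 \<subseteq> A \<and> committee A \<and> hall I l A \<and>
     0 \<le> l \<and> l \<le> u \<and> u \<le> quota \<and> (\<forall>v. attainable v \<longrightarrow> v \<le> 2 * u)"

lemma bracket_initial:
  assumes saturated: "saturated (cands I) quota A0"
    and A_committee: "committee A" "quarter_optimal A0 A"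
    and m_greatest: "\<And>t. t \<le> m \<longleftrightarrow> t \<le> quota \<and> hall I t A"
  shows "bracket A0 A m (min (2 * m) quota)"
proof -
  have "0 \<le> m" "m \<le> quota" "hall I m A"
    using m_greatest[of 0] m_greatest[of m] quota_nonneg hall_nonpos by auto
  moreover have "v \<le> 4 * m" if v_attainable: "attainable v" for v
  proof -
    have le_quota: "v / 4 \<le> quota"
      using attainable_le_quota[OF v_attainable] quota_nonneg by linarith
    then have "hall I (v / 4) A0"
      using saturated hall_antimono unfolding saturated_def by blast
    then have "hall I (v / 4) A"
      using A_committee(2) v_attainable by (simp add: quarter_optimal_def)
    then show ?thesis using m_greatest[of "v / 4"] le_quota by simp
  qed
  moreover have "v \<le> 2 * quota" if "attainable v" for v
    using attainable_le_quota[OF that] quota_nonneg by linarith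
  ultimately show ?thesis
    using saturated A_committee by (simp add: bracket_def quarter_optimal_def min_def)
qed

lemma bracket_raise:
  assumes "bracket A0 A l u" "l \<le> t" "t \<le> u" "A0 \<subseteq> A'" "saturated C t A'" "card A' = seats I"
  shows "bracket A0 A' t u"
  using assms by (auto simp: bracket_def saturated_def committee_def)

lemma bracket_lower:
  assumes "bracket A0 A l u" "l \<le> t" "t \<le> u" "saturated (cands I) t A'" "card A' < seats I"
  shows "bracket A0 A l t"
  using assms attainable_less_twice[OF assms(4,5)] by (force simp: bracket_def)

lemma bracket_approximation:
  assumes bracket: "bracket A0 A l u" and balanced: "balanced I A w"
    and eps_pos: "0 < \<epsilon>" and gap: "2 * u \<le> l * (2 + \<epsilon>)"
  shows "approximation (2 + \<epsilon>) I A w"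
proof -
  have A_committee: "A \<subseteq> cands I" "card A = seats I" and hall: "hall I l A"
    using bracket by (auto simp: bracket_def committee_def)
  have full: "full_solution I A w"
    using A_committee balanced_feasible[OF balanced] by (simp add: full_solution_def)
  have "opt I \<le> 2 * u" using bracket by (intro opt_le[OF full]) (simp add: bracket_def)
  then have "opt I / (2 + \<epsilon>) \<le> l" using eps_pos gap by (simp add: pos_divide_le_eq)
  also have "l \<le> min_supp I w A"
    using balanced_supp_ge[OF balanced A_committee(1) hall] A_committee(2) seats_pos
      finite_if_subset_cands[OF A_committee(1)]
    unfolding min_supp_def by (subst Min_ge_iff) auto
  finally show ?thesis using full by (simp add: approximation_def)
qed

lemma bracket_PJR: "bracket A0 A l u \<Longrightarrow> 0 < sum (strength I) (voters I) \<Longrightarrow> PJR I A"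
  by (intro PJR_if_saturated_quota[of A0]) (auto simp: bracket_def)

end

section \<open>Total correctness with a time bound\<close>

type_synonym subroutine = "(nat \<Rightarrow> nat) \<Rightarrow> (nat \<Rightarrow> real) \<times> nat"

definition run :: "subroutine \<Rightarrow> prog \<Rightarrow> store \<Rightarrow> real \<Rightarrow> (store \<Rightarrow> bool) \<Rightarrow> bool" where
  "run f p s b Q \<longleftrightarrow> (\<exists>t s'. exec f p s t s' \<and> real t \<le> b \<and> Q s')"

fun nat_writes :: "prog \<Rightarrow> name set" where
  "nat_writes (NSet x i a) = {x}"
| "nat_writes (Seq p q) = nat_writes p \<union> nat_writes q"
| "nat_writes (Cond b p q) = nat_writes p \<union> nat_writes q"
| "nat_writes (While b p) = nat_writes p"
| "nat_writes _ = {}"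

fun real_writes :: "prog \<Rightarrow> name set" where
  "real_writes (RSet x i a) = {x}"
| "real_writes (Call x y) = {y}"
| "real_writes (Seq p q) = real_writes p \<union> real_writes q"
| "real_writes (Cond b p q) = real_writes p \<union> real_writes q"
| "real_writes (While b p) = real_writes p"
| "real_writes _ = {}"

definition frame :: "prog \<Rightarrow> store \<Rightarrow> store \<Rightarrow> bool" where
  "frame p s s' \<longleftrightarrow> (\<forall>x. x \<notin> nat_writes p \<longrightarrow> nats s' x = nats s x) \<and>
     (\<forall>x. x \<notin> real_writes p \<longrightarrow> reals s' x = reals s x)"

lemma frame_nats: "frame p s s' \<Longrightarrow> x \<notin> nat_writes p \<Longrightarrow> nats s' x = nats s x"
  and frame_reals: "frame p s s' \<Longrightarrow> x \<notin> real_writes p \<Longrightarrow> reals s' x = reals s x"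
  by (auto simp: frame_def)

lemma frame_trans: "frame p s s' \<Longrightarrow> frame p s' s'' \<Longrightarrow> frame p s s''"
  by (simp add: frame_def)

lemma frame_mono:
  "frame p s s' \<Longrightarrow> nat_writes p \<subseteq> nat_writes q \<Longrightarrow> real_writes p \<subseteq> real_writes q \<Longrightarrow> frame q s s'"
  unfolding frame_def by blast

lemma store_upd_simps [simp]:
  "nats (nupd x i v s) y = (if y = x then (nats s x)(i := v) else nats s y)"
  "reals (nupd x i v s) = reals s"
  "reals (rupd x i r s) y = (if y = x then (reals s x)(i := r) else reals s y)"
  "nats (rupd x i r s) = nats s"
  by (auto simp: nupd_def rupd_def)

lemma frame_nupd: "x \<in> nat_writes p \<Longrightarrow> frame p s (nupd x i v s)"
  by (auto simp: frame_def)

lemma exec_frame: "exec f p s t s' \<Longrightarrow> frame p s s'"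
  by (induction rule: exec.induct) (auto simp: frame_def)

lemma run_mono:
  assumes "run f p s b Q" "b \<le> b'" "\<And>s'. Q s' \<Longrightarrow> frame p s s' \<Longrightarrow> Q' s'"
  shows "run f p s b' Q'"
  using assms exec_frame unfolding run_def by (meson order_trans)

lemma run_Skip: "Q s \<Longrightarrow> 1 \<le> b \<Longrightarrow> run f Skip s b Q"
  unfolding run_def using exec.Skip by fastforce

lemma run_NSet: "Q (nupd x (nval i s) (nval a s) s) \<Longrightarrow> 1 \<le> b \<Longrightarrow> run f (NSet x i a) s b Q"
  unfolding run_def using exec.NSet by (metis of_nat_1)

lemma run_RSet: "Q (rupd x (nval i s) (rval a s) s) \<Longrightarrow> 1 \<le> b \<Longrightarrow> run f (RSet x i a) s b Q"
  unfolding run_def using exec.RSet by (metis of_nat_1)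

lemma run_Call:
  assumes "Q (s\<lparr>reals := (reals s)(y := fst (f (nats s x)))\<rparr>)" "real (snd (f (nats s x))) \<le> b"
  shows "run f (Call x y) s b Q"
  using assms exec.Call[of f s x "fst (f (nats s x))" "snd (f (nats s x))" y]
  unfolding run_def by fastforce

lemma run_Seq:
  assumes run_p: "run f p s b P" and run_q: "\<And>s'. P s' \<Longrightarrow> frame p s s' \<Longrightarrow> run f q s' c Q"
    and time: "b + c \<le> d"
  shows "run f (Seq p q) s d Q"
proof -
  obtain t s' where exec_p: "exec f p s t s'" "real t \<le> b" and "P s'"
    using run_p unfolding run_def by blast
  then obtain u s'' where exec_q: "exec f q s' u s''" "real u \<le> c" "Q s''"
    using run_q exec_frame unfolding run_def by blast
  show ?thesis
    unfolding run_def using exec.Seq[OF exec_p(1) exec_q(1)] exec_p(2) exec_q(2,3) time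
    by (intro exI[of _ "t + u"] exI[of _ s'']) auto
qed

lemma run_Seq_NSet:
  "run f q (nupd x (nval i s) (nval a s) s) c Q \<Longrightarrow> 1 + c \<le> d \<Longrightarrow> run f (Seq (NSet x i a) q) s d Q"
  by (rule run_Seq[where P = "\<lambda>s'. s' = nupd x (nval i s) (nval a s) s", OF run_NSet]) auto

lemma run_Seq_RSet:
  "run f q (rupd x (nval i s) (rval a s) s) c Q \<Longrightarrow> 1 + c \<le> d \<Longrightarrow> run f (Seq (RSet x i a) q) s d Q"
  by (rule run_Seq[where P = "\<lambda>s'. s' = rupd x (nval i s) (rval a s) s", OF run_RSet]) auto

lemma run_Cond:
  assumes "bval c s \<Longrightarrow> run f p s b Q" "\<not> bval c s \<Longrightarrow> run f q s b Q" "1 + b \<le> d"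
  shows "run f (Cond c p q) s d Q"
proof -
  obtain t s' where "exec f (Cond c p q) s (1 + t) s'" "real t \<le> b" "Q s'"
    using assms(1,2) exec.CondT[of c s f p _ _ q] exec.CondF[of c s f q _ _ p]
    unfolding run_def by (cases "bval c s") blast+
  then show ?thesis
    using assms(3) unfolding run_def by (intro exI[of _ "1 + t"] exI[of _ s']) auto
qed

lemma run_While:
  assumes step: "\<And>n s. Inv n s \<Longrightarrow> bval c s \<Longrightarrow> 0 < n \<and> run f p s b (Inv (n - 1))"
    and b_nonneg: "0 \<le> b" and init: "Inv n s"
  shows "run f (While c p) s (1 + real n * (b + 1)) (\<lambda>s'. \<not> bval c s' \<and> (\<exists>m. Inv m s'))"
  using init
proof (induction n arbitrary: s)
  case 0
  then have "\<not> bval c s" using step by blast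
  then show ?case
    using exec.WhileF[of c s f p] 0 unfolding run_def by (intro exI[of _ 1] exI[of _ s]) auto
next
  case (Suc n)
  show ?case
  proof (cases "bval c s")
    case True
    then obtain t s' where body: "exec f p s t s'" "real t \<le> b" "Inv n s'"
      using step[OF Suc.prems] unfolding run_def by auto
    then obtain u s'' where rest: "exec f (While c p) s' u s''" "real u \<le> 1 + real n * (b + 1)"
      "\<not> bval c s'' \<and> (\<exists>m. Inv m s'')"
      using Suc.IH unfolding run_def by blast
    show ?thesis
      unfolding run_def using exec.WhileT[OF True body(1) rest(1)] body(2) rest(2,3)
      by (intro exI[of _ "1 + t + u"] exI[of _ s'']) (auto simp: algebra_simps)
  next
    case False
    then show ?thesis
      using exec.WhileF[of c s f p] Suc.prems b_nonneg
      unfolding run_def by (intro exI[of _ 1] exI[of _ s]) auto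
  qed
qed

section \<open>Counting loops\<close>

abbreviation nvar :: "name \<Rightarrow> nexp" where "nvar x \<equiv> NGet x (NConst 0)"
abbreviation rvar :: "name \<Rightarrow> rexp" where "rvar x \<equiv> RGet x (NConst 0)"
abbreviation nset :: "name \<Rightarrow> nexp \<Rightarrow> prog" where "nset x a \<equiv> NSet x (NConst 0) a"
abbreviation rset :: "name \<Rightarrow> rexp \<Rightarrow> prog" where "rset x a \<equiv> RSet x (NConst 0) a"
abbreviation incr :: "name \<Rightarrow> prog" where "incr x \<equiv> nset x (NAdd (nvar x) (NConst 1))"
abbreviation rnum :: "nat \<Rightarrow> rexp" where "rnum m \<equiv> RNat (NConst m)"

definition For :: "name \<Rightarrow> name \<Rightarrow> prog \<Rightarrow> prog" where
  "For x n p = Seq (nset x (NConst 0)) (While (NLess (nvar x) (nvar n)) (Seq p (incr x)))"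

lemma writes_For [simp]:
  "nat_writes (For x n p) = insert x (nat_writes p)"
  "real_writes (For x n p) = real_writes p"
  by (auto simp: For_def)

lemma run_For:
  assumes names: "x \<noteq> n" "x \<notin> nat_writes p" "n \<notin> nat_writes p" and b_nonneg: "0 \<le> b"
    and stable: "\<And>i k s. Inv i (nupd x 0 k s) \<longleftrightarrow> Inv i s"
    and init: "Inv 0 s"
    and step: "\<And>i s'. i < nats s n 0 \<Longrightarrow> Inv i s' \<Longrightarrow> nats s' x 0 = i \<Longrightarrow> frame (For x n p) s s' \<Longrightarrow>
      run f p s' b (Inv (Suc i))"
    and post: "\<And>s'. Inv (nats s n 0) s' \<Longrightarrow> Q s'"
    and time: "2 + real (nats s n 0) * (b + 2) \<le> d"
  shows "run f (For x n p) s d Q"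
proof -
  let ?test = "NLess (nvar x) (nvar n)"
  define N where "N = nats s n 0"
  define Remaining where "Remaining k s' \<longleftrightarrow>
    k + nats s' x 0 = N \<and> Inv (nats s' x 0) s' \<and> frame (For x n p) s s'" for k s'
  have bound: "nats s' n 0 = N" if "Remaining k s'" for k s'
    using that frame_nats[of "For x n p" s s' n] names by (simp add: Remaining_def N_def)
  have body: "0 < k \<and> run f (Seq p (incr x)) s' (b + 1) (Remaining (k - 1))"
    if left: "Remaining k s'" and test: "bval ?test s'" for k s'
  proof -
    define i where "i = nats s' x 0"
    have i_less: "i < N" "k + i = N" "Inv i s'" and frame: "frame (For x n p) s s'"
      using left test bound[OF left] by (auto simp: Remaining_def i_def)
    have "run f (Seq p (incr x)) s' (b + 1) (Remaining (k - 1))"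
    proof (rule run_Seq[OF step])
      fix s'' assume invariant: "Inv (Suc i) s''" and frame': "frame p s' s''"
      have "frame (For x n p) s (nupd x 0 (Suc i) s'')"
        using frame_trans[OF frame frame_mono[OF frame']] frame_trans frame_nupd by fastforce
      moreover have "nats s'' x 0 = i" using frame_nats[OF frame'] names by (simp add: i_def)
      ultimately show "run f (incr x) s'' 1 (Remaining (k - 1))"
        using invariant i_less stable by (intro run_NSet) (auto simp: Remaining_def)
    qed (use i_less frame in \<open>auto simp: N_def i_def\<close>)
    with i_less show ?thesis by simp
  qed
  have start: "Remaining N (nupd x 0 0 s)"
    using init stable by (simp add: Remaining_def frame_nupd)
  have "run f (While ?test (Seq p (incr x))) (nupd x 0 0 s) (1 + real N * (b + 2)) Q"
  proof (rule run_mono[OF run_While[where Inv = Remaining, OF body _ start]])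
    fix s' assume "\<not> bval ?test s' \<and> (\<exists>k. Remaining k s')"
    then obtain k where left: "Remaining k s'" and "\<not> bval ?test s'" by blast
    then have "nats s' x 0 = N" using bound[OF left] by (simp add: Remaining_def)
    with left show "Q s'" using post by (simp add: Remaining_def N_def)
  qed (use b_nonneg in \<open>auto simp: algebra_simps\<close>)
  then show ?thesis
    unfolding For_def using time by (intro run_Seq_NSet) (auto simp: N_def)
qed

abbreviation idx :: nexp where "idx \<equiv> nvar ''j''"

definition nfill :: "name \<Rightarrow> name \<Rightarrow> nexp \<Rightarrow> prog" where
  "nfill n x a = For ''j'' n (NSet x idx a)"

definition rfill :: "name \<Rightarrow> name \<Rightarrow> rexp \<Rightarrow> prog" where
  "rfill n x e = For ''j'' n (RSet x idx e)"

definition accum :: "name \<Rightarrow> name \<Rightarrow> nexp \<Rightarrow> rexp \<Rightarrow> prog" where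
  "accum n x a e = For ''j'' n (RSet x a (RAdd (RGet x a) e))"

definition tally :: "name \<Rightarrow> name \<Rightarrow> nat \<Rightarrow> name \<Rightarrow> nexp \<Rightarrow> rexp \<Rightarrow> prog" where
  "tally n x k m a e = Seq (rfill n x (rnum k)) (accum m x a e)"

lemma writes_fill [simp]:
  "nat_writes (nfill n x a) = {''j'', x}" "real_writes (nfill n x a) = {}"
  "nat_writes (rfill n x e) = {''j''}" "real_writes (rfill n x e) = {x}"
  "nat_writes (accum n x a e) = {''j''}" "real_writes (accum n x a e) = {x}"
  "nat_writes (tally n x k m a e) = {''j''}" "real_writes (tally n x k m a e) = {x}"
  by (auto simp: nfill_def rfill_def accum_def tally_def)

lemma run_nfill:
  assumes names: "n \<noteq> ''j''" "x \<noteq> ''j''" "x \<noteq> n" and time: "2 + 3 * real (nats s n 0) \<le> d"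
    and evaluates: "\<And>j s'. j < nats s n 0 \<Longrightarrow> nats s' ''j'' 0 = j \<Longrightarrow> frame (nfill n x a) s s' \<Longrightarrow>
      nval a s' = v j"
  shows "run f (nfill n x a) s d (\<lambda>s'. \<forall>i<nats s n 0. nats s' x i = v i)"
  unfolding nfill_def
proof (rule run_For[where b = 1 and Inv = "\<lambda>j s'. \<forall>i<j. nats s' x i = v i"])
  fix i s'
  assume "i < nats s n 0" "\<forall>k<i. nats s' x k = v k" "nats s' ''j'' 0 = i"
    "frame (For ''j'' n (NSet x idx a)) s s'"
  with evaluates show "run f (NSet x idx a) s' 1 (\<lambda>s''. \<forall>k<Suc i. nats s'' x k = v k)"
    by (intro run_NSet) (auto simp: nfill_def less_Suc_eq)
qed (use names time in auto)

lemma run_rfill: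
  assumes n_not_counter: "n \<noteq> ''j''" and time: "2 + 3 * real (nats s n 0) \<le> d"
    and evaluates: "\<And>j s'. j < nats s n 0 \<Longrightarrow> nats s' ''j'' 0 = j \<Longrightarrow> frame (rfill n x e) s s' \<Longrightarrow>
      rval e s' = v j"
  shows "run f (rfill n x e) s d (\<lambda>s'. \<forall>i<nats s n 0. reals s' x i = v i)"
  unfolding rfill_def
proof (rule run_For[where b = 1 and Inv = "\<lambda>j s'. \<forall>i<j. reals s' x i = v i"])
  fix i s'
  assume "i < nats s n 0" "\<forall>k<i. reals s' x k = v k" "nats s' ''j'' 0 = i"
    "frame (For ''j'' n (RSet x idx e)) s s'"
  with evaluates show "run f (RSet x idx e) s' 1 (\<lambda>s''. \<forall>k<Suc i. reals s'' x k = v k)"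
    by (intro run_RSet) (auto simp: rfill_def less_Suc_eq)
qed (use n_not_counter time in auto)

lemma run_accum:
  assumes n_not_counter: "n \<noteq> ''j''" and time: "2 + 3 * real (nats s n 0) \<le> d"
    and evaluates: "\<And>j s'. j < nats s n 0 \<Longrightarrow> nats s' ''j'' 0 = j \<Longrightarrow> frame (accum n x a e) s s' \<Longrightarrow>
      nval a s' = h j \<and> rval e s' = v j"
  shows "run f (accum n x a e) s d
    (\<lambda>s'. \<forall>i. reals s' x i = reals s x i + (\<Sum>j | j < nats s n 0 \<and> h j = i. v j))"
  unfolding accum_def
proof (rule run_For[where b = 1 and Inv = "\<lambda>m s'. \<forall>i. reals s' x i =
    reals s x i + (\<Sum>j | j < m \<and> h j = i. v j)"])
  let ?p = "RSet x a (RAdd (RGet x a) e)"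
  fix m s'
  assume invariant: "\<forall>i. reals s' x i = reals s x i + (\<Sum>j | j < m \<and> h j = i. v j)"
    and j_counter: "m < nats s n 0" "nats s' ''j'' 0 = m" and frame: "frame (For ''j'' n ?p) s s'"
  have "nval a s' = h m" "rval e s' = v m" using evaluates j_counter frame by (auto simp: accum_def)
  with invariant show "run f ?p s' 1
      (\<lambda>s''. \<forall>i. reals s'' x i = reals s x i + (\<Sum>j | j < Suc m \<and> h j = i. v j))"
    by (intro run_RSet) (auto simp: sum_less_Suc_if)
qed (use n_not_counter time in auto)

lemma run_tally:
  assumes names: "n \<noteq> ''j''" "m \<noteq> ''j''"
    and time: "4 + 3 * real (nats s n 0) + 3 * real (nats s m 0) \<le> d"
    and evaluates: "\<And>j s'. j < nats s m 0 \<Longrightarrow> nats s' ''j'' 0 = j \<Longrightarrow> frame (tally n x k m a e) s s' \<Longrightarrow>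
      nval a s' = h j \<and> rval e s' = v j"
  shows "run f (tally n x k m a e) s d
    (\<lambda>s'. \<forall>i<nats s n 0. reals s' x i = real k + (\<Sum>j | j < nats s m 0 \<and> h j = i. v j))"
  unfolding tally_def
proof (rule run_Seq)
  show "run f (rfill n x (rnum k)) s (2 + 3 * real (nats s n 0))
    (\<lambda>s'. \<forall>i<nats s n 0. reals s' x i = real k)"
    using names(1) by (intro run_rfill) auto
  fix s1
  assume init: "\<forall>i<nats s n 0. reals s1 x i = real k" and frame1: "frame (rfill n x (rnum k)) s s1"
  have m_unchanged: "nats s1 m = nats s m" using frame_nats[OF frame1] names by simp
  show "run f (accum m x a e) s1 (2 + 3 * real (nats s m 0))
    (\<lambda>s'. \<forall>i<nats s n 0. reals s' x i = real k + (\<Sum>j | j < nats s m 0 \<and> h j = i. v j))"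
  proof (rule run_mono[OF run_accum])
    fix j s' assume j_counter: "j < nats s1 m 0" "nats s' ''j'' 0 = j"
      and frame: "frame (accum m x a e) s1 s'"
    have "frame (tally n x k m a e) s s'"
      by (rule frame_trans[OF frame_mono[OF frame1] frame_mono[OF frame]]) auto
    then show "nval a s' = h j \<and> rval e s' = v j"
      using evaluates j_counter by (simp add: m_unchanged)
  qed (use names init in \<open>auto simp: m_unchanged\<close>)
qed (use time in simp)

section \<open>The algorithm\<close>

text \<open>
  The arrays \<open>cur\<close>, \<open>base\<close> and \<open>committee\<close> are indicators of the committee under construction, of
  the set from which all scans start, and of the best committee so far; \<open>cnt\<close> and \<open>bcnt\<close> are the
  sizes of the first two. The bisection maintains that \<open>committee\<close> has value at least \<open>lo\<close> and that
  the optimum is at most \<open>2 * up\<close>.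
\<close>

abbreviation chosen :: "nexp \<Rightarrow> bexp" where "chosen i \<equiv> NLess (NConst 0) (NGet ''cur'' i)"
abbreviation below_seats :: bexp where "below_seats \<equiv> NLess (nvar ''cnt'') (nvar ''seats'')"
abbreviation addable :: "nexp \<Rightarrow> bexp" where "addable i \<equiv> BAnd below_seats (BNot (chosen i))"

definition copy :: "name \<Rightarrow> name \<Rightarrow> prog" where
  "copy x y = nfill ''numcands'' x (NGet y idx)"

definition supports :: prog where
  "supports = tally ''numcands'' ''sup'' 0 ''numedges'' (NGet ''cand'' idx) (RGet ''w'' idx)"

definition minimum_step :: prog where
  "minimum_step =
     Cond (BAnd (chosen idx) (RLess (RGet ''sup'' idx) (rvar ''mn'')))
       (rset ''mn'' (RGet ''sup'' idx)) Skip"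

definition minimum :: prog where
  "minimum = Seq (rset ''mn'' (rvar ''thr'')) (For ''j'' ''numcands'' minimum_step)"

definition evaluate :: prog where
  "evaluate = Seq (Call ''cur'' ''w'') (Seq supports minimum)"

definition try_cand :: prog where
  "try_cand = Seq (NSet ''cur'' (nvar ''i'') (NConst 1)) (Seq evaluate
     (Cond (RLess (rvar ''mn'') (rvar ''thr''))
       (NSet ''cur'' (nvar ''i'') (NConst 0)) (incr ''cnt'')))"

definition scan_step :: prog where
  "scan_step = Cond (addable (nvar ''i'')) try_cand Skip"

definition scan :: prog where
  "scan = For ''i'' ''numcands'' scan_step"

text \<open>The factor \<open>x / x\<close> is the indicator of \<open>x \<noteq> 0\<close>.\<close>

definition loads :: prog where
  "loads = tally ''numvoters'' ''load'' 0 ''numedges'' (NGet ''voter'' idx)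
     (RMul (RDiv (RNat (NGet ''cur'' (NGet ''cand'' idx))) (RNat (NGet ''cur'' (NGet ''cand'' idx))))
       (RDiv (RGet ''w'' idx) (RGet ''sup'' (NGet ''cand'' idx))))"

definition scores :: prog where
  "scores =
     Seq (tally ''numcands'' ''num'' 0 ''numedges'' (NGet ''cand'' idx)
       (RGet ''strength'' (NGet ''voter'' idx)))
    (Seq (tally ''numcands'' ''den'' 1 ''numedges'' (NGet ''cand'' idx)
      (RGet ''load'' (NGet ''voter'' idx)))
         (rfill ''numcands'' ''score'' (RDiv (RGet ''num'' idx) (RGet ''den'' idx))))"

definition score_cands :: prog where
  "score_cands = Seq (Call ''cur'' ''w'') (Seq supports (Seq loads scores))"

text \<open>The value \<open>numcands\<close> of \<open>best\<close> means that no candidate outside the committee was found yet.\<close>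

definition select_step :: prog where
  "select_step =
     Cond (BAnd (BNot (chosen idx)) (BNot (BAnd (NLess (nvar ''best'') (nvar ''numcands''))
         (RLess (RGet ''score'' idx) (RGet ''score'' (nvar ''best''))))))
       (nset ''best'' idx) Skip"

definition select_best :: prog where
  "select_best = Seq (nset ''best'' (nvar ''numcands'')) (For ''j'' ''numcands'' select_step)"

definition add_best :: prog where
  "add_best = Seq score_cands (Seq select_best
     (Seq (NSet ''cur'' (nvar ''best'') (NConst 1)) (incr ''cnt'')))"

definition greedy_step :: prog where
  "greedy_step = Cond below_seats add_best Skip"

definition greedy :: prog where
  "greedy = For ''i'' ''numcands'' greedy_step"

definition set_quota :: prog where
  "set_quota =
     Seq (rset ''tot'' (rnum 0))
    (Seq (accum ''numvoters'' ''tot'' (NConst 0) (RGet ''strength'' idx))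
         (rset ''thr'' (RDiv (rvar ''tot'') (RNat (nvar ''seats'')))))"

definition clear :: prog where
  "clear = Seq (nfill ''numcands'' ''cur'' (NConst 0)) (nset ''cnt'' (NConst 0))"

definition seed :: prog where
  "seed = Seq clear (Seq scan (Seq (copy ''base'' ''cur'') (nset ''bcnt'' (nvar ''cnt''))))"

definition set_bracket :: prog where
  "set_bracket =
     Seq (rset ''lo'' (rvar ''mn''))
    (Seq (Cond (RLess (RMul (rnum 2) (rvar ''lo'')) (rvar ''thr''))
           (rset ''up'' (RMul (rnum 2) (rvar ''lo''))) (rset ''up'' (rvar ''thr'')))
         (copy ''committee'' ''cur''))"

definition find_bracket :: prog where
  "find_bracket = Seq greedy (Seq evaluate set_bracket)"

definition rescan :: prog where
  "rescan = Seq (copy ''cur'' ''base'') (Seq (nset ''cnt'' (nvar ''bcnt'')) scan)"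

definition narrow :: prog where
  "narrow = Cond below_seats (rset ''up'' (rvar ''thr''))
     (Seq (rset ''lo'' (rvar ''thr'')) (copy ''committee'' ''cur''))"

definition bisect :: prog where
  "bisect = Seq (rset ''thr'' (RDiv (RAdd (rvar ''lo'') (rvar ''up'')) (rnum 2)))
    (Seq rescan narrow)"

definition unfinished :: bexp where
  "unfinished =
     RLess (RMul (rvar ''lo'') (RAdd (rnum 2) (rvar ''eps''))) (RMul (rnum 2) (rvar ''up''))"

definition lazy_mms :: prog where
  "lazy_mms = Seq set_quota (Seq seed (Seq find_bracket
     (Seq (While unfinished bisect) (Call ''committee'' ''weight''))))"

lemma writes_blocks [simp]:
  "nat_writes (copy x y) = {''j'', x}" "real_writes (copy x y) = {}"
  "nat_writes supports = {''j''}" "real_writes supports = {''sup''}"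
  "nat_writes minimum_step = {}" "real_writes minimum_step = {''mn''}"
  "nat_writes minimum = {''j''}" "real_writes minimum = {''mn''}"
  "nat_writes evaluate = {''j''}" "real_writes evaluate = {''w'', ''sup'', ''mn''}"
  "nat_writes try_cand = {''j'', ''cur'', ''cnt''}"
  "real_writes try_cand = {''w'', ''sup'', ''mn''}"
  "nat_writes scan_step = {''j'', ''cur'', ''cnt''}"
  "real_writes scan_step = {''w'', ''sup'', ''mn''}"
  "nat_writes scan = {''i'', ''j'', ''cur'', ''cnt''}" "real_writes scan = {''w'', ''sup'', ''mn''}"
  "nat_writes loads = {''j''}" "real_writes loads = {''load''}"
  "nat_writes scores = {''j''}" "real_writes scores = {''num'', ''den'', ''score''}"
  "nat_writes score_cands = {''j''}"
  "real_writes score_cands = {''w'', ''sup'', ''load'', ''num'', ''den'', ''score''}"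
  "nat_writes select_step = {''best''}" "real_writes select_step = {}"
  "nat_writes select_best = {''j'', ''best''}" "real_writes select_best = {}"
  "nat_writes add_best = {''j'', ''best'', ''cur'', ''cnt''}"
  "real_writes add_best = {''w'', ''sup'', ''load'', ''num'', ''den'', ''score''}"
  "nat_writes greedy_step = {''j'', ''best'', ''cur'', ''cnt''}"
  "real_writes greedy_step = {''w'', ''sup'', ''load'', ''num'', ''den'', ''score''}"
  "nat_writes greedy = {''i'', ''j'', ''best'', ''cur'', ''cnt''}"
  "real_writes greedy = {''w'', ''sup'', ''load'', ''num'', ''den'', ''score''}"
  "nat_writes rescan = {''i'', ''j'', ''cur'', ''cnt''}"
  "real_writes rescan = {''w'', ''sup'', ''mn''}"
  by (auto simp: copy_def supports_def minimum_step_def minimum_def evaluate_def try_cand_def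
      scan_step_def scan_def loads_def scores_def score_cands_def select_step_def select_best_def
      add_best_def greedy_step_def greedy_def rescan_def)

section \<open>Correctness of the building blocks\<close>

lemma decode_cands_subset: "decode_cands cs a \<subseteq> set cs"
  unfolding decode_cands_def by auto

lemma nth_in_decode_cands_iff:
  "distinct cs \<Longrightarrow> i < length cs \<Longrightarrow> cs ! i \<in> decode_cands cs a \<longleftrightarrow> a i \<noteq> 0"
  unfolding decode_cands_def by (auto simp: nth_eq_iff_index_eq)

lemma decode_cands_insert:
  "i < length cs \<Longrightarrow> v \<noteq> 0 \<Longrightarrow> decode_cands cs (a(i := v)) = insert (cs ! i) (decode_cands cs a)"
  unfolding decode_cands_def by auto

lemma decode_cands_cong:
  "(\<And>i. i < length cs \<Longrightarrow> a i = b i) \<Longrightarrow> decode_cands cs a = decode_cands cs b"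
  unfolding decode_cands_def by auto

definition input_nats :: "name set" where
  [simp]: "input_nats = {''numvoters'', ''numcands'', ''numedges'', ''seats'', ''voter'', ''cand''}"
definition input_reals :: "name set" where
  [simp]: "input_reals = {''strength'', ''eps''}"

abbreviation preserves_input :: "prog \<Rightarrow> bool" where
  "preserves_input p \<equiv> nat_writes p \<inter> input_nats = {} \<and> real_writes p \<inter> input_reals = {}"

locale machine = valid_election I for I :: "('v, 'c) election" +
  fixes vs :: "'v list" and cs :: "'c list" and es :: "('v \<times> 'c) list" and \<epsilon> :: real
    and solve :: "'c set \<Rightarrow> 'v \<times> 'c \<Rightarrow> real" and time :: "'c set \<Rightarrow> nat" and bal :: real
  assumes enumerates: "enumerates I vs cs es" and eps_pos: "0 < \<epsilon>"
    and balancing_procedure: "balancing_procedure I solve time bal"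
begin

abbreviation balancer :: subroutine where "balancer \<equiv> subroutine cs es solve time"
abbreviation inp :: "store \<Rightarrow> bool" where "inp \<equiv> input_store I vs cs es \<epsilon>"

lemma distinct_vs: "distinct vs" and set_vs: "set vs = voters I"
  and distinct_cs: "distinct cs" and set_cs: "set cs = cands I"
  and distinct_es: "distinct es" and set_es: "set es = edges I"
  using enumerates unfolding enumerates_def by auto

lemma length_vs: "length vs = card (voters I)"
  and length_cs: "length cs = card (cands I)"
  and length_es: "length es = card (edges I)"
  using distinct_vs set_vs distinct_cs set_cs distinct_es set_es distinct_card by metis+

lemma solve_balanced: "A \<subseteq> cands I \<Longrightarrow> card A \<le> seats I \<Longrightarrow> balanced I A (solve A)"
  and time_le: "A \<subseteq> cands I \<Longrightarrow> card A \<le> seats I \<Longrightarrow> real (time A + length es) \<le> bal"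
  using balancing_procedure unfolding balancing_procedure_def length_es by auto

lemma length_es_le_bal: "real (length es) \<le> bal"
  using time_le[of "{}"] by simp

lemma length_cs_le_bal: "real (length cs) \<le> bal" and length_vs_le_bal: "real (length vs) \<le> bal"
  using length_es_le_bal card_cands_le_card_edges card_voters_le_card_edges
  unfolding length_cs length_vs length_es by simp_all

lemma length_cs_ge_1: "1 \<le> real (length cs)"
  using seats_less unfolding length_cs by simp

lemma bal_ge_1: "1 \<le> bal"
  using length_cs_ge_1 length_cs_le_bal by simp

lemma bal_le_bal_mult_length_cs: "bal \<le> bal * real (length cs)"
  using bal_ge_1 length_cs_ge_1 by (simp add: mult_le_cancel_left1)

lemma inp_numvoters: "inp s \<Longrightarrow> nats s ''numvoters'' 0 = length vs"
  and inp_numcands: "inp s \<Longrightarrow> nats s ''numcands'' 0 = length cs"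
  and inp_numedges: "inp s \<Longrightarrow> nats s ''numedges'' 0 = length es"
  and inp_seats: "inp s \<Longrightarrow> nats s ''seats'' 0 = seats I"
  and inp_eps: "inp s \<Longrightarrow> reals s ''eps'' 0 = \<epsilon>"
  and inp_strength: "inp s \<Longrightarrow> i < length vs \<Longrightarrow> reals s ''strength'' i = strength I (vs ! i)"
  and inp_voter_less: "inp s \<Longrightarrow> j < length es \<Longrightarrow> nats s ''voter'' j < length vs"
  and inp_cand_less: "inp s \<Longrightarrow> j < length es \<Longrightarrow> nats s ''cand'' j < length cs"
  and inp_edge: "inp s \<Longrightarrow> j < length es \<Longrightarrow> es ! j = (vs ! nats s ''voter'' j, cs ! nats s ''cand'' j)"
  unfolding input_store_def by auto

lemma inp_cong:
  assumes "\<And>x. x \<in> input_nats \<Longrightarrow> nats s' x = nats s x" "\<And>x. x \<in> input_reals \<Longrightarrow> reals s' x = reals s x"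
  shows "inp s' \<longleftrightarrow> inp s"
  unfolding input_store_def using assms by simp

lemma inp_nupd [simp]: "x \<notin> input_nats \<Longrightarrow> inp (nupd x i v s) \<longleftrightarrow> inp s"
  and inp_rupd [simp]: "x \<notin> input_reals \<Longrightarrow> inp (rupd x i r s) \<longleftrightarrow> inp s"
  by (rule inp_cong; force)+

lemma inp_frame: "inp s \<Longrightarrow> frame p s s' \<Longrightarrow> preserves_input p \<Longrightarrow> inp s'"
  using inp_cong[of s' s] by (blast intro: frame_nats frame_reals)

lemma run_Seq_inp:
  assumes "inp s" "run balancer p s b P" "preserves_input p"
    and "\<And>s'. inp s' \<Longrightarrow> P s' \<Longrightarrow> frame p s s' \<Longrightarrow> run balancer q s' c Q" "b + c \<le> d"
  shows "run balancer (Seq p q) s d Q"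
  using assms inp_frame by (intro run_Seq[OF assms(2)]) blast+

lemma run_For_cands:
  assumes inp: "inp s" and names: "x \<notin> input_nats" "x \<notin> nat_writes p" "preserves_input p"
    and b_nonneg: "0 \<le> b"
    and stable: "\<And>i k s. Inv i (nupd x 0 k s) \<longleftrightarrow> Inv i s"
    and init: "Inv 0 s"
    and step: "\<And>i s'. i < length cs \<Longrightarrow> inp s' \<Longrightarrow> Inv i s' \<Longrightarrow> nats s' x 0 = i \<Longrightarrow>
      frame (For x ''numcands'' p) s s' \<Longrightarrow> run balancer p s' b (Inv (Suc i))"
    and post: "\<And>s'. Inv (length cs) s' \<Longrightarrow> Q s'"
    and time: "2 + real (length cs) * (b + 2) \<le> d"
  shows "run balancer (For x ''numcands'' p) s d Q"
proof (rule run_For[where b = b and Inv = Inv])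
  fix i s'
  assume i_counter: "i < nats s ''numcands'' 0" "Inv i s'" "nats s' x 0 = i"
    and frame: "frame (For x ''numcands'' p) s s'"
  have "inp s'" using names by (intro inp_frame[OF inp frame]) auto
  with i_counter frame show "run balancer p s' b (Inv (Suc i))"
    using step by (simp add: inp_numcands[OF inp])
qed (use names b_nonneg stable init post time in \<open>auto simp: inp_numcands[OF inp]\<close>)

lemma run_copy:
  assumes "inp s" "x \<noteq> ''j''" "y \<noteq> ''j''" "x \<noteq> y" "x \<noteq> ''numcands''"
  shows "run balancer (copy x y) s (5 * bal)
    (\<lambda>s'. decode_cands cs (nats s' x) = decode_cands cs (nats s y))"
proof (rule run_mono)
  show "run balancer (copy x y) s (5 * bal)
    (\<lambda>s'. \<forall>i<nats s ''numcands'' 0. nats s' x i = nats s y i)"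
    unfolding copy_def
  proof (rule run_nfill)
    fix j s' assume "nats s' ''j'' 0 = j" "frame (nfill ''numcands'' x (NGet y idx)) s s'"
    then show "nval (NGet y idx) s' = nats s y j"
      using frame_nats[of _ s s' y] assms by fastforce
  qed (use assms inp_numcands[OF assms(1)] length_cs_le_bal bal_ge_1 in auto)
  fix s' assume "\<forall>i<nats s ''numcands'' 0. nats s' x i = nats s y i"
  then show "decode_cands cs (nats s' x) = decode_cands cs (nats s y)"
    using inp_numcands[OF assms(1)] by (intro decode_cands_cong) simp
qed simp

lemma run_tally_edges:
  assumes inp: "inp s" and x_not_input: "x \<notin> input_reals" and names: "n \<noteq> ''j''" "key \<noteq> ''j''"
    and length: "nats s n 0 = length xs" "real (length xs) \<le> bal" and distinct: "distinct xs"
    and key: "\<And>j. j < length es \<Longrightarrow> nats s key j < length xs \<and> p (es ! j) = xs ! nats s key j"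
    and evaluates: "\<And>j s'. j < length es \<Longrightarrow> inp s' \<Longrightarrow> nats s' ''j'' 0 = j \<Longrightarrow>
      frame (tally n x k ''numedges'' (NGet key idx) e) s s' \<Longrightarrow> rval e s' = g (es ! j)"
  shows "run balancer (tally n x k ''numedges'' (NGet key idx) e) s (10 * bal)
    (\<lambda>s'. \<forall>i<length xs. reals s' x i = real k + (\<Sum>y | y \<in> edges I \<and> p y = xs ! i. g y))"
proof (rule run_mono[OF run_tally[where h = "nats s key" and v = "\<lambda>j. g (es ! j)"]])
  fix j s'
  assume j_counter: "j < nats s ''numedges'' 0" "nats s' ''j'' 0 = j"
    and frame: "frame (tally n x k ''numedges'' (NGet key idx) e) s s'"
  have "inp s'" using x_not_input by (intro inp_frame[OF inp frame]) auto
  then show "nval (NGet key idx) s' = nats s key j \<and> rval e s' = g (es ! j)"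
    using evaluates j_counter frame frame_nats[OF frame] names
    by (simp add: inp_numedges[OF inp])
next
  fix s' assume "\<forall>i<nats s n 0. reals s' x i =
    real k + (\<Sum>j | j < nats s ''numedges'' 0 \<and> nats s key j = i. g (es ! j))"
  then show "\<forall>i<length xs. reals s' x i = real k + (\<Sum>y | y \<in> edges I \<and> p y = xs ! i. g y)"
    using sum_nth_key[where key = "nats s key" and p = p and g = g, OF distinct distinct_es _ key]
      length
    by (simp add: inp_numedges[OF inp] set_es)
qed (use names length length_es_le_bal bal_ge_1 in \<open>auto simp: inp_numedges[OF inp]\<close>)

lemma run_tally_cands:
  assumes inp: "inp s" and x_not_input: "x \<notin> input_reals"
    and evaluates: "\<And>j s'. j < length es \<Longrightarrow> inp s' \<Longrightarrow> nats s' ''j'' 0 = j \<Longrightarrow>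
      frame (tally ''numcands'' x k ''numedges'' (NGet ''cand'' idx) e) s s' \<Longrightarrow>
      rval e s' = g (es ! j)"
  shows "run balancer (tally ''numcands'' x k ''numedges'' (NGet ''cand'' idx) e) s (10 * bal)
    (\<lambda>s'. \<forall>i<length cs. reals s' x i = real k + (\<Sum>n\<in>voters_of I (cs ! i). g (n, cs ! i)))"
  unfolding sum_edges_of_cand[symmetric]
  by (rule run_tally_edges[OF inp x_not_input _ _
        inp_numcands[OF inp] length_cs_le_bal distinct_cs])
    (simp_all add: inp_edge[OF inp] inp_cand_less[OF inp] evaluates)

lemma run_tally_voters:
  assumes inp: "inp s" and x_not_input: "x \<notin> input_reals"
    and evaluates: "\<And>j s'. j < length es \<Longrightarrow> inp s' \<Longrightarrow> nats s' ''j'' 0 = j \<Longrightarrow>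
      frame (tally ''numvoters'' x k ''numedges'' (NGet ''voter'' idx) e) s s' \<Longrightarrow>
      rval e s' = g (es ! j)"
  shows "run balancer (tally ''numvoters'' x k ''numedges'' (NGet ''voter'' idx) e) s (10 * bal)
    (\<lambda>s'. \<forall>i<length vs. reals s' x i = real k + (\<Sum>c\<in>cands_of I (vs ! i). g (vs ! i, c)))"
  unfolding sum_edges_of_voter[symmetric]
  by (rule run_tally_edges[OF inp x_not_input _ _
        inp_numvoters[OF inp] length_vs_le_bal distinct_vs])
    (simp_all add: inp_edge[OF inp] inp_voter_less[OF inp] evaluates)

abbreviation current :: "store \<Rightarrow> 'c set" where "current s \<equiv> decode_cands cs (nats s ''cur'')"
abbreviation thr :: "store \<Rightarrow> real" where "thr s \<equiv> reals s ''thr'' 0"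

definition tracked :: "store \<Rightarrow> bool" where
  "tracked s \<longleftrightarrow> nats s ''cnt'' 0 = card (current s) \<and> card (current s) \<le> seats I"

lemma current_subset: "current s \<subseteq> cands I"
  using decode_cands_subset set_cs by metis

lemma finite_current: "finite (current s)"
  using current_subset by (rule finite_if_subset_cands)

lemma nth_in_current_iff: "i < length cs \<Longrightarrow> cs ! i \<in> current s \<longleftrightarrow> nats s ''cur'' i \<noteq> 0"
  using distinct_cs by (rule nth_in_decode_cands_iff)

lemma tracked_insert:
  assumes "tracked s" "i < length cs" "cs ! i \<notin> current s" "card (current s) < seats I"
    and "nats s' ''cur'' = (nats s ''cur'')(i := 1)" "nats s' ''cnt'' 0 = Suc (nats s ''cnt'' 0)"
  shows "current s' = insert (cs ! i) (current s)" "tracked s'"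
  using assms finite_current[of s] by (simp_all add: tracked_def decode_cands_insert)

lemma run_call_cur:
  assumes "card (current s) \<le> seats I"
  shows "run balancer (Call ''cur'' ''w'') s bal
    (\<lambda>s'. \<forall>j<length es. reals s' ''w'' j = solve (current s) (es ! j))"
  using assms time_le[OF current_subset]
  by (intro run_Call) (auto simp: subroutine_def Let_def)

lemma run_supports:
  assumes inp: "inp s" and weights: "\<forall>j<length es. reals s ''w'' j = w (es ! j)"
  shows "run balancer supports s (10 * bal)
    (\<lambda>s'. \<forall>i<length cs. reals s' ''sup'' i = supp I w (cs ! i))"
  unfolding supports_def
proof (rule run_mono[OF run_tally_cands[OF inp, where g = w]])
  fix j s'
  assume "j < length es" "nats s' ''j'' 0 = j"
    and frame: "frame (tally ''numcands'' ''sup'' 0 ''numedges'' (NGet ''cand'' idx)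
      (RGet ''w'' idx)) s s'"
  then show "rval (RGet ''w'' idx) s' = w (es ! j)"
    using weights by (simp add: frame_reals[OF frame])
qed (auto simp: supp_def)

lemma run_minimum:
  assumes inp: "inp s"
  shows "run balancer minimum s (8 * bal) (\<lambda>s'. \<forall>t. t \<le> reals s' ''mn'' 0 \<longleftrightarrow> t \<le> thr s \<and>
    (\<forall>i<length cs. nats s ''cur'' i \<noteq> 0 \<longrightarrow> t \<le> reals s ''sup'' i))"
  (is "run balancer minimum s _ (?Inv (length cs))")
  unfolding minimum_def
proof (rule run_Seq_RSet)
  let ?s = "rupd ''mn'' (nval (NConst 0) s) (rval (rvar ''thr'') s) s"
  show "run balancer (For ''j'' ''numcands'' minimum_step) ?s (7 * bal) (?Inv (length cs))"
  proof (rule run_For_cands[where Inv = ?Inv and b = 2])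
    fix i s'
    assume invariant: "?Inv i s'" and counter: "nats s' ''j'' 0 = i"
      and frame: "frame (For ''j'' ''numcands'' minimum_step) ?s s'"
    have unchanged: "nats s' ''cur'' = nats s ''cur''" "reals s' ''sup'' = reals s ''sup''"
      using frame_nats[OF frame] frame_reals[OF frame] by simp_all
    show "run balancer minimum_step s' 2 (?Inv (Suc i))"
      unfolding minimum_step_def
    proof (rule run_Cond[where b = 1])
      assume "bval (BAnd (chosen idx) (RLess (RGet ''sup'' idx) (rvar ''mn''))) s'"
      then show "run balancer (rset ''mn'' (RGet ''sup'' idx)) s' 1 (?Inv (Suc i))"
        using invariant counter unchanged by (intro run_RSet) (auto simp: less_Suc_eq)
    next
      assume "\<not> bval (BAnd (chosen idx) (RLess (RGet ''sup'' idx) (rvar ''mn''))) s'"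
      then show "run balancer Skip s' 1 (?Inv (Suc i))"
        using invariant counter unchanged
        by (intro run_Skip) (auto simp: less_Suc_eq intro: order.trans[of _ "reals s' ''mn'' 0"])
    qed simp
  qed (use inp length_cs_le_bal bal_ge_1 in auto)
qed (use bal_ge_1 in simp)

lemma run_evaluate:
  assumes inp: "inp s" and card: "card (current s) \<le> seats I"
  shows "run balancer evaluate s (19 * bal)
    (\<lambda>s'. \<forall>t. t \<le> reals s' ''mn'' 0 \<longleftrightarrow> t \<le> thr s \<and> hall I t (current s))"
  (is "run balancer evaluate s _ ?Q")
  unfolding evaluate_def
proof (rule run_Seq_inp[OF inp run_call_cur[OF card]])
  let ?w = "solve (current s)"
  have hall_iff: "hall I t (current s) \<longleftrightarrow>
    (\<forall>i<length cs. nats s ''cur'' i \<noteq> 0 \<longrightarrow> t \<le> supp I ?w (cs ! i))" for t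
    unfolding hall_iff_balanced_supp_ge[OF solve_balanced[OF current_subset card] current_subset]
    by (auto simp: decode_cands_def)
  fix s1
  assume inp1: "inp s1" and weights: "\<forall>j<length es. reals s1 ''w'' j = ?w (es ! j)"
    and frame1: "frame (Call ''cur'' ''w'') s s1"
  show "run balancer (Seq supports minimum) s1 (18 * bal) ?Q"
  proof (rule run_Seq_inp[OF inp1 run_supports[where w = ?w, OF inp1 weights]])
    fix s2
    assume inp2: "inp s2" and supports: "\<forall>i<length cs. reals s2 ''sup'' i = supp I ?w (cs ! i)"
      and frame2: "frame supports s1 s2"
    have "nats s2 ''cur'' = nats s ''cur''" "reals s2 ''thr'' = reals s ''thr''"
      by (simp_all add: frame_nats[OF frame1] frame_reals[OF frame1] frame_nats[OF frame2]
        frame_reals[OF frame2])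
    then show "run balancer minimum s2 (8 * bal) ?Q"
      by (intro run_mono[OF run_minimum[OF inp2]]) (simp_all add: hall_iff supports)
  qed auto
qed auto

section \<open>Correctness of the scan\<close>

lemma run_try_cand:
  assumes inp: "inp s" and tracked: "tracked s" and not_full: "card (current s) < seats I"
    and i_cand: "nats s ''i'' 0 = i" "i < length cs" "nats s ''cur'' i = 0"
  defines "A \<equiv> insert (cs ! i) (current s)"
  shows "run balancer try_cand s (22 * bal)
    (\<lambda>s'. tracked s' \<and> current s' = (if hall I (thr s) A then A else current s))"
  (is "run balancer _ s _ ?Q")
  unfolding try_cand_def
proof (rule run_Seq_NSet)
  let ?s1 = "nupd ''cur'' (nval (nvar ''i'') s) (nval (NConst 1) s) s"
  let ?decide = "Cond (RLess (rvar ''mn'') (rvar ''thr''))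
    (NSet ''cur'' (nvar ''i'') (NConst 0)) (incr ''cnt'')"
  have notin: "cs ! i \<notin> current s" using i_cand by (simp add: nth_in_current_iff)
  have current1: "current ?s1 = A" using i_cand by (simp add: A_def decode_cands_insert)
  have inp1: "inp ?s1" using inp by simp
  have card1: "card (current ?s1) \<le> seats I"
    using not_full notin finite_current[of s] unfolding current1 by (simp add: A_def)
  show "run balancer (Seq evaluate ?decide) ?s1 (21 * bal) ?Q"
  proof (rule run_Seq_inp[OF inp1 run_evaluate[OF inp1 card1]])
    fix s2
    assume minimum: "\<forall>t. t \<le> reals s2 ''mn'' 0 \<longleftrightarrow> t \<le> thr ?s1 \<and> hall I t (current ?s1)"
      and frame: "frame evaluate ?s1 s2"
    have unchanged: "nats s2 ''cur'' = (nats s ''cur'')(i := 1)" "nats s2 ''cnt'' = nats s ''cnt''"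
      "nats s2 ''i'' 0 = i" "reals s2 ''thr'' = reals s ''thr''"
      using frame_nats[OF frame] frame_reals[OF frame] i_cand by simp_all
    have accept: "thr s \<le> reals s2 ''mn'' 0 \<longleftrightarrow> hall I (thr s) A"
      using minimum unfolding current1 by simp
    show "run balancer ?decide s2 (2 * bal) ?Q"
    proof (rule run_Cond[where b = 1])
      assume "bval (RLess (rvar ''mn'') (rvar ''thr'')) s2"
      moreover have "(nats s ''cur'')(i := 0) = nats s ''cur''" using i_cand(3) by auto
      ultimately show "run balancer (NSet ''cur'' (nvar ''i'') (NConst 0)) s2 1 ?Q"
        using accept tracked by (intro run_NSet) (simp_all add: unchanged tracked_def)
    next
      assume "\<not> bval (RLess (rvar ''mn'') (rvar ''thr'')) s2"
      moreover define s3 where "s3 = nupd ''cnt'' 0 (Suc (nats s ''cnt'' 0)) s2"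
      moreover have "current s3 = A" "tracked s3"
        using tracked_insert[OF tracked i_cand(2) notin not_full, of s3]
        by (simp_all add: s3_def unchanged A_def)
      ultimately show "run balancer (incr ''cnt'') s2 1 ?Q"
        using accept by (intro run_NSet) (simp_all add: unchanged)
    qed (use bal_ge_1 in simp)
  qed auto
qed (use bal_ge_1 in simp)

lemma run_scan_step:
  assumes inp: "inp s" and tracked: "tracked s" and i_cand: "nats s ''i'' 0 = i" "i < length cs"
    and saturated: "saturated C (thr s) (current s)"
  shows "run balancer scan_step s (23 * bal) (\<lambda>s'. tracked s' \<and> current s \<subseteq> current s' \<and>
    saturated (insert (cs ! i) C) (thr s) (current s'))"
  (is "run balancer _ s _ ?Q")
  unfolding scan_step_def
proof (rule run_Cond[where b = "22 * bal"])
  assume "bval (addable (nvar ''i'')) s"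
  then have not_full: "card (current s) < seats I" and not_chosen: "nats s ''cur'' i = 0"
    using tracked i_cand(1) by (auto simp: tracked_def inp_seats[OF inp])
  have "cs ! i \<in> cands I - current s"
    using i_cand(2) not_chosen set_cs nth_mem[OF i_cand(2)] by (simp add: nth_in_current_iff)
  then show "run balancer try_cand s (22 * bal) ?Q"
    using saturated_add[OF saturated _ not_full] saturated_skip[OF saturated, of "cs ! i"]
    by (intro run_mono[OF run_try_cand[OF inp tracked not_full i_cand not_chosen]])
      (auto split: if_splits)
next
  assume "\<not> bval (addable (nvar ''i'')) s"
  then have "cs ! i \<in> current s \<or> card (current s) = seats I"
    using tracked i_cand by (auto simp: tracked_def inp_seats[OF inp] nth_in_current_iff)
  then show "run balancer Skip s (22 * bal) ?Q"
    using tracked saturated_skip[OF saturated] bal_ge_1 by (intro run_Skip) auto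
qed (use bal_ge_1 in simp)

lemma run_scan:
  assumes inp: "inp s" and tracked: "tracked s" and hall: "hall I (thr s) (current s)"
  shows "run balancer scan s (27 * (bal * real (length cs)))
    (\<lambda>s'. tracked s' \<and> current s \<subseteq> current s' \<and> saturated (cands I) (thr s) (current s'))"
proof -
  define Inv where "Inv i s' \<longleftrightarrow> tracked s' \<and> current s \<subseteq> current s' \<and>
    saturated (set (take i cs)) (thr s) (current s')" for i s'
  show ?thesis
    unfolding scan_def
  proof (rule run_For_cands[where Inv = Inv and b = "23 * bal"])
    fix i s'
    assume i_less: "i < length cs" and inp': "inp s'" and invariant: "Inv i s'"
      and counter: "nats s' ''i'' 0 = i"
      and frame: "frame (For ''i'' ''numcands'' scan_step) s s'"
    have thr_unchanged: "reals s' ''thr'' = reals s ''thr''" using frame_reals[OF frame] by simp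
    have tracked': "tracked s'" and saturated: "saturated (set (take i cs)) (thr s') (current s')"
      using invariant by (auto simp: Inv_def thr_unchanged)
    show "run balancer scan_step s' (23 * bal) (Inv (Suc i))"
      using invariant i_less
      by (intro run_mono[OF run_scan_step[OF inp' tracked' counter i_less saturated]])
        (auto simp: Inv_def thr_unchanged take_Suc_conv_app_nth)
  next
    show "Inv 0 s"
      using tracked hall current_subset by (simp add: Inv_def saturated_empty tracked_def)
  next
    show "2 + real (length cs) * (23 * bal + 2) \<le> 27 * (bal * real (length cs))"
      using bal_ge_1 length_cs_ge_1 mult_right_mono[OF bal_ge_1, of "real (length cs)"]
      by (simp add: algebra_simps)
  qed (use inp bal_ge_1 in \<open>auto simp: Inv_def tracked_def set_cs\<close>)
qed

section \<open>Correctness of the greedy phase\<close>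

lemma run_loads:
  assumes inp: "inp s" and weights: "\<forall>j<length es. reals s ''w'' j = w (es ! j)"
    and supports: "\<forall>i<length cs. reals s ''sup'' i = supp I w (cs ! i)"
  shows "run balancer loads s (10 * bal)
    (\<lambda>s'. \<forall>i<length vs. reals s' ''load'' i = load (current s) w (vs ! i))"
proof -
  define g where "g = (\<lambda>(n, c). if c \<in> current s then w (n, c) / supp I w c else 0)"
  have "run balancer loads s (10 * bal)
    (\<lambda>s'. \<forall>i<length vs. reals s' ''load'' i = real 0 + (\<Sum>c\<in>cands_of I (vs ! i). g (vs ! i, c)))"
    unfolding loads_def
  proof (rule run_tally_voters[OF inp], goal_cases)
    case (2 j s')
    then have j_counter: "j < length es" "nats s' ''j'' 0 = j" and frame: "frame loads s s'"
      by (simp_all add: loads_def)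
    define i where "i = nats s ''cand'' j"
    have i_cand: "i < length cs" "snd (es ! j) = cs ! i"
      using inp_cand_less[OF inp j_counter(1)] inp_edge[OF inp j_counter(1)]
      by (simp_all add: i_def)
    have "g (es ! j) = (if nats s ''cur'' i \<noteq> 0 then w (es ! j) / supp I w (cs ! i) else 0)"
      using i_cand nth_in_current_iff[OF i_cand(1)] by (cases "es ! j") (simp add: g_def)
    then show ?case
      using j_counter i_cand frame_nats[OF frame] frame_reals[OF frame] weights supports
      by (simp flip: i_def)
  qed simp
  then show ?thesis
    by (rule run_mono) (auto simp: g_def load_def sum.inter_restrict finite_cands_of)
qed

lemma run_scores:
  assumes inp: "inp s" and load: "\<forall>i<length vs. reals s ''load'' i = load A w (vs ! i)"
  shows "run balancer scores s (25 * bal)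
    (\<lambda>s'. \<forall>i<length cs. reals s' ''score'' i = score A w (cs ! i))"
  (is "run balancer _ s _ ?Q")
  unfolding scores_def
proof (rule run_Seq_inp[OF inp run_tally_cands[where g = "\<lambda>(n, c). strength I n", OF inp]])
  let ?den = "tally ''numcands'' ''den'' 1 ''numedges'' (NGet ''cand'' idx)
    (RGet ''load'' (NGet ''voter'' idx))"
  let ?quot = "rfill ''numcands'' ''score'' (RDiv (RGet ''num'' idx) (RGet ''den'' idx))"
  show "rval (RGet ''strength'' (NGet ''voter'' idx)) s' = (case es ! j of (n, c) \<Rightarrow> strength I n)"
    if "j < length es" "inp s'" "nats s' ''j'' 0 = j" for j s'
    using that by (simp add: inp_edge[OF that(2)] inp_strength inp_voter_less)
  fix s1
  assume inp1: "inp s1" and numerators: "\<forall>i<length cs. reals s1 ''num'' i =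
      real 0 + (\<Sum>n\<in>voters_of I (cs ! i). case (n, cs ! i) of (n, c) \<Rightarrow> strength I n)"
    and frame1: "frame (tally ''numcands'' ''num'' 0 ''numedges'' (NGet ''cand'' idx)
      (RGet ''strength'' (NGet ''voter'' idx))) s s1"
  show "run balancer (Seq ?den ?quot) s1 (15 * bal) ?Q"
  proof (rule run_Seq_inp[OF inp1 run_tally_cands[where g = "\<lambda>(n, c). load A w n", OF inp1]])
    show "rval (RGet ''load'' (NGet ''voter'' idx)) s' = (case es ! j of (n, c) \<Rightarrow> load A w n)"
      if "j < length es" "inp s'" "nats s' ''j'' 0 = j" "frame ?den s1 s'" for j s'
      using that(1-3) load
      by (simp add: inp_edge inp_voter_less frame_reals[OF frame1] frame_reals[OF that(4)])
    fix s2
    assume inp2: "inp s2" and denominators: "\<forall>i<length cs. reals s2 ''den'' i =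
        real 1 + (\<Sum>n\<in>voters_of I (cs ! i). case (n, cs ! i) of (n, c) \<Rightarrow> load A w n)"
      and frame2: "frame ?den s1 s2"
    have "reals s2 ''num'' i / reals s2 ''den'' i = score A w (cs ! i)" if "i < length cs" for i
      using that numerators denominators frame_reals[OF frame2] by (simp add: score_def)
    then show "run balancer ?quot s2 (5 * bal) ?Q"
      using length_cs_le_bal bal_ge_1
      by (intro run_mono[OF run_rfill[where v = "\<lambda>i. score A w (cs ! i)"]])
        (auto simp: inp_numcands[OF inp2] frame_reals)
  qed auto
qed auto

lemma run_score_cands:
  assumes inp: "inp s" and card: "card (current s) \<le> seats I"
  shows "run balancer score_cands s (46 * bal)
    (\<lambda>s'. \<forall>i<length cs. reals s' ''score'' i = score (current s) (solve (current s)) (cs ! i))"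
  (is "run balancer _ s _ ?Q")
  unfolding score_cands_def
proof (rule run_Seq_inp[OF inp run_call_cur[OF card]])
  let ?w = "solve (current s)"
  fix s1
  assume inp1: "inp s1" and weights: "\<forall>j<length es. reals s1 ''w'' j = ?w (es ! j)"
    and frame1: "frame (Call ''cur'' ''w'') s s1"
  show "run balancer (Seq supports (Seq loads scores)) s1 (45 * bal) ?Q"
  proof (rule run_Seq_inp[OF inp1 run_supports[where w = ?w, OF inp1 weights]])
    fix s2
    assume inp2: "inp s2" and supports: "\<forall>i<length cs. reals s2 ''sup'' i = supp I ?w (cs ! i)"
      and frame2: "frame supports s1 s2"
    have weights2: "\<forall>j<length es. reals s2 ''w'' j = ?w (es ! j)"
      using weights frame_reals[OF frame2] by simp
    have "current s2 = current s" by (simp add: frame_nats[OF frame1] frame_nats[OF frame2])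
    then show "run balancer (Seq loads scores) s2 (35 * bal) ?Q"
      using run_scores
      by (intro run_Seq_inp[OF inp2 run_loads[where w = ?w, OF inp2 weights2 supports]]) auto
  qed auto
qed auto

lemma run_select_best:
  assumes inp: "inp s" and exists_outside: "\<exists>i<length cs. nats s ''cur'' i = 0"
  shows "run balancer select_best s (8 * bal) (\<lambda>s'. is_arg_max (reals s ''score'')
    (\<lambda>i. i < length cs \<and> nats s ''cur'' i = 0) (nats s' ''best'' 0))"
  (is "run balancer _ s _ ?Q")
  unfolding select_best_def
proof (rule run_Seq_NSet)
  let ?s = "nupd ''best'' (nval (NConst 0) s) (nval (nvar ''numcands'') s) s"
  let ?Inv = "\<lambda>m s'. if \<exists>i<m. nats s ''cur'' i = 0
    then is_arg_max (reals s ''score'') (\<lambda>i. i < m \<and> nats s ''cur'' i = 0) (nats s' ''best'' 0)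
    else nats s' ''best'' 0 = length cs"
  show "run balancer (For ''j'' ''numcands'' select_step) ?s (7 * bal) ?Q"
  proof (rule run_For_cands[where Inv = ?Inv and b = 2])
    fix m s'
    assume m_less: "m < length cs" and inp': "inp s'" and invariant: "?Inv m s'"
      and counter: "nats s' ''j'' 0 = m"
      and frame: "frame (For ''j'' ''numcands'' select_step) ?s s'"
    have unchanged: "nats s' ''cur'' = nats s ''cur''" "reals s' ''score'' = reals s ''score''"
      using frame_nats[OF frame] frame_reals[OF frame] by simp_all
    show "run balancer select_step s' 2 (?Inv (Suc m))"
      unfolding select_step_def
      using invariant m_less counter
      by (intro run_Cond[where b = 1] run_NSet run_Skip)
        (auto simp: unchanged inp_numcands[OF inp'] is_arg_max_linorder less_Suc_eq
          split: if_splits)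
  qed (use inp exists_outside length_cs_le_bal bal_ge_1 in \<open>auto simp: inp_numcands[OF inp]\<close>)
qed (use bal_ge_1 in simp)

lemma run_add_best:
  assumes inp: "inp s" and tracked: "tracked s" and not_full: "card (current s) < seats I"
  shows "run balancer add_best s (56 * bal)
    (\<lambda>s'. tracked s' \<and> (\<exists>c. current s' = insert c (current s) \<and> c \<notin> current s \<and>
    is_arg_max (score (current s) (solve (current s))) (\<lambda>c. c \<in> cands I - current s) c))"
  (is "run balancer _ s _ ?Q")
  unfolding add_best_def
proof (rule run_Seq_inp[OF inp run_score_cands[OF inp]])
  let ?A = "current s"
  let ?add = "Seq (NSet ''cur'' (nvar ''best'') (NConst 1)) (incr ''cnt'')"
  have outside: "c \<in> cands I - ?A \<longleftrightarrow> (\<exists>i<length cs. c = cs ! i \<and> nats s ''cur'' i = 0)" for c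
    unfolding set_cs[symmetric] by (auto simp: in_set_conv_nth nth_in_current_iff)
  fix s1
  assume inp1: "inp s1"
    and score: "\<forall>i<length cs. reals s1 ''score'' i = score ?A (solve ?A) (cs ! i)"
    and frame1: "frame score_cands s s1"
  have unchanged1: "nats s1 ''cur'' = nats s ''cur''" "nats s1 ''cnt'' = nats s ''cnt''"
    using frame_nats[OF frame1] by simp_all
  show "run balancer (Seq select_best ?add) s1 (10 * bal) ?Q"
  proof (rule run_Seq_inp[OF inp1 run_select_best[OF inp1]])
    have "?A \<noteq> cands I" using not_full seats_less by auto
    then show "\<exists>i<length cs. nats s1 ''cur'' i = 0"
      using current_subset outside by (auto simp: unchanged1)
    fix s2
    assume best: "is_arg_max (reals s1 ''score'') (\<lambda>i. i < length cs \<and> nats s1 ''cur'' i = 0)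
      (nats s2 ''best'' 0)" and frame2: "frame select_best s1 s2"
    define b where "b = nats s2 ''best'' 0"
    have b_outside: "b < length cs" "nats s ''cur'' b = 0"
      using best by (auto simp: is_arg_max_linorder b_def unchanged1)
    have arg_max: "is_arg_max (score ?A (solve ?A)) (\<lambda>c. c \<in> cands I - ?A) (cs ! b)"
      using best b_outside score unfolding is_arg_max_linorder outside
      by (auto simp: b_def unchanged1)
    have notin: "cs ! b \<notin> ?A" using b_outside by (simp add: nth_in_current_iff)
    have unchanged2: "nats s2 ''cur'' = nats s ''cur''" "nats s2 ''cnt'' = nats s ''cnt''"
      using frame_nats[OF frame2] unchanged1 by simp_all
    define s3 where "s3 = nupd ''cnt'' 0 (Suc (nats s ''cnt'' 0)) (nupd ''cur'' b 1 s2)"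
    have "current s3 = insert (cs ! b) ?A" "tracked s3"
      using tracked_insert[OF tracked b_outside(1) notin not_full, of s3]
      by (simp_all add: s3_def unchanged2)
    then have "?Q s3" using arg_max notin by blast
    then show "run balancer ?add s2 (2 * bal) ?Q"
      using bal_ge_1
      by (intro run_Seq_NSet[where c = 1] run_NSet) (simp_all add: s3_def b_def unchanged2)
  qed auto
qed (use not_full in auto)

lemma run_greedy:
  assumes inp: "inp s" and tracked: "tracked s"
  shows "run balancer greedy s (61 * (bal * real (length cs)))
    (\<lambda>s'. committee (current s') \<and> quarter_optimal (current s) (current s'))"
proof -
  define Inv where "Inv i s' \<longleftrightarrow> tracked s' \<and> min i (seats I) \<le> card (current s') \<and>
    quarter_optimal (current s) (current s')" for i s'
  show ?thesis
    unfolding greedy_def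
  proof (rule run_For_cands[where Inv = Inv and b = "57 * bal"])
    fix i s'
    assume inp': "inp s'" and invariant: "Inv i s'"
    then have tracked': "tracked s'" by (simp add: Inv_def)
    show "run balancer greedy_step s' (57 * bal) (Inv (Suc i))"
      unfolding greedy_step_def
    proof (rule run_Cond[where b = "56 * bal"])
      assume "bval below_seats s'"
      then have not_full: "card (current s') < seats I"
        using tracked' by (simp add: tracked_def inp_seats[OF inp'])
      have balanced: "balanced I (current s') (solve (current s'))"
        using not_full current_subset by (intro solve_balanced) auto
      show "run balancer add_best s' (56 * bal) (Inv (Suc i))"
        using invariant quarter_optimal_insert[OF _ balanced current_subset not_full]
          finite_current[of s']
        by (intro run_mono[OF run_add_best[OF inp' tracked' not_full]]) (auto simp: Inv_def)
    next
      assume "\<not> bval below_seats s'"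
      then show "run balancer Skip s' (56 * bal) (Inv (Suc i))"
        using invariant bal_ge_1 inp_seats[OF inp']
        by (intro run_Skip) (auto simp: Inv_def tracked_def)
    qed (use bal_ge_1 in simp)
  next
    show "Inv 0 s" using tracked by (simp add: Inv_def quarter_optimal_refl)
  next
    show "committee (current s') \<and> quarter_optimal (current s) (current s')"
      if "Inv (length cs) s'" for s'
      using that seats_less current_subset
      by (simp add: Inv_def committee_def tracked_def length_cs)
  next
    show "2 + real (length cs) * (57 * bal + 2) \<le> 61 * (bal * real (length cs))"
      using bal_ge_1 length_cs_ge_1 mult_right_mono[OF bal_ge_1, of "real (length cs)"]
      by (simp add: algebra_simps)
  qed (use inp bal_ge_1 in \<open>auto simp: Inv_def tracked_def\<close>)
qed

section \<open>Correctness of the bisection\<close>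

abbreviation base :: "store \<Rightarrow> 'c set" where "base s \<equiv> decode_cands cs (nats s ''base'')"
abbreviation incumbent :: "store \<Rightarrow> 'c set"
  where "incumbent s \<equiv> decode_cands cs (nats s ''committee'')"
abbreviation lo :: "store \<Rightarrow> real" where "lo s \<equiv> reals s ''lo'' 0"
abbreviation up :: "store \<Rightarrow> real" where "up s \<equiv> reals s ''up'' 0"

definition seeded :: "store \<Rightarrow> bool" where
  "seeded s \<longleftrightarrow> saturated (cands I) quota (base s) \<and> nats s ''bcnt'' 0 = card (base s)"

definition bracketed :: "store \<Rightarrow> bool" where
  "bracketed s \<longleftrightarrow> seeded s \<and> bracket (base s) (incumbent s) (lo s) (up s)"

lemma run_set_quota:
  assumes inp: "inp s"
  shows "run balancer set_quota s (7 * bal) (\<lambda>s'. thr s' = quota)"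
  unfolding set_quota_def
proof (rule run_Seq_RSet)
  let ?s = "rupd ''tot'' (nval (NConst 0) s) (rval (rnum 0) s) s"
  let ?sum = "accum ''numvoters'' ''tot'' (NConst 0) (RGet ''strength'' idx)"
  let ?thr = "rset ''thr'' (RDiv (rvar ''tot'') (RNat (nvar ''seats'')))"
  have inp0: "inp ?s" using inp by simp
  have strength_sum: "run balancer ?sum ?s (5 * bal)
    (\<lambda>s'. reals s' ''tot'' 0 = sum (strength I) (voters I))"
  proof (rule run_mono[OF run_accum[where h = "\<lambda>_. 0" and v = "\<lambda>j. strength I (vs ! j)"]])
    show "nval (NConst 0) s' = 0 \<and> rval (RGet ''strength'' idx) s' = strength I (vs ! j)"
      if "j < nats ?s ''numvoters'' 0" "nats s' ''j'' 0 = j" "frame ?sum ?s s'" for j s'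
      using that inp_strength[OF inp] by (simp add: inp_numvoters[OF inp] frame_reals[OF that(3)])
    fix s' assume "\<forall>i. reals s' ''tot'' i =
      reals ?s ''tot'' i + (\<Sum>j | j < nats ?s ''numvoters'' 0 \<and> 0 = i. strength I (vs ! j))"
    then show "reals s' ''tot'' 0 = sum (strength I) (voters I)"
      using sum_nth_filter[OF distinct_vs, where P = "\<lambda>_. True"]
      by (simp add: inp_numvoters[OF inp] set_vs)
  qed (use length_vs_le_bal bal_ge_1 in \<open>auto simp: inp_numvoters[OF inp]\<close>)
  show "run balancer (Seq ?sum ?thr) ?s (6 * bal) (\<lambda>s'. thr s' = quota)"
    using bal_ge_1
    by (intro run_Seq_inp[OF inp0 strength_sum, where c = 1] run_RSet)
      (simp_all add: quota_def inp_seats)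
qed (use bal_ge_1 in simp)

lemma run_clear:
  assumes inp: "inp s"
  shows "run balancer clear s (6 * bal) (\<lambda>s'. current s' = {} \<and> tracked s')"
  unfolding clear_def
proof (rule run_Seq)
  show "run balancer (nfill ''numcands'' ''cur'' (NConst 0)) s (5 * bal)
    (\<lambda>s'. \<forall>i<nats s ''numcands'' 0. nats s' ''cur'' i = 0)"
    using inp_numcands[OF inp] length_cs_le_bal bal_ge_1 by (intro run_nfill) auto
  fix s' :: store assume "\<forall>i<nats s ''numcands'' 0. nats s' ''cur'' i = 0"
  then have "current s' = {}" using inp_numcands[OF inp] by (simp add: decode_cands_def)
  then show "run balancer (nset ''cnt'' (NConst 0)) s' bal (\<lambda>s'. current s' = {} \<and> tracked s')"
    using bal_ge_1 by (intro run_NSet) (simp_all add: tracked_def)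
qed simp

lemma run_seed:
  assumes inp: "inp s" and thr_quota: "thr s = quota"
  shows "run balancer seed s (39 * (bal * real (length cs)))
    (\<lambda>s'. seeded s' \<and> thr s' = quota \<and> base s' = current s' \<and> tracked s')"
  (is "run balancer _ s _ ?Q")
  unfolding seed_def
proof (rule run_Seq_inp[OF inp run_clear[OF inp]])
  let ?save = "Seq (copy ''base'' ''cur'') (nset ''bcnt'' (nvar ''cnt''))"
  fix s1
  assume inp1: "inp s1" and cleared: "current s1 = {} \<and> tracked s1" and frame1: "frame clear s s1"
  have thr1_quota: "thr s1 = quota" using frame_reals[OF frame1] thr_quota by (simp add: clear_def)
  have hall: "hall I (thr s1) (current s1)" using cleared by (simp add: hall_empty)
  show "run balancer (Seq scan ?save) s1 (33 * (bal * real (length cs))) ?Q"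
  proof (rule run_Seq_inp[OF inp1 run_scan[OF inp1 _ hall]])
    fix s2
    assume inp2: "inp s2" and frame2: "frame scan s1 s2"
      and scanned: "tracked s2 \<and> current s1 \<subseteq> current s2 \<and>
        saturated (cands I) (thr s1) (current s2)"
    have thr2_quota: "thr s2 = quota" using frame_reals[OF frame2] thr1_quota by simp
    show "run balancer ?save s2 (6 * bal) ?Q"
    proof (rule run_Seq_inp[OF inp2 run_copy[OF inp2]])
      fix s3 assume "base s3 = current s2" and frame3: "frame (copy ''base'' ''cur'') s2 s3"
      then show "run balancer (nset ''bcnt'' (nvar ''cnt'')) s3 bal ?Q"
        using bal_ge_1 frame_nats[OF frame3] frame_reals[OF frame3] thr1_quota thr2_quota scanned
        by (intro run_NSet) (simp_all add: seeded_def tracked_def)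
    qed auto
  qed (use cleared bal_le_bal_mult_length_cs in auto)
qed (use bal_le_bal_mult_length_cs in \<open>auto simp: clear_def\<close>)

lemma run_set_bracket:
  assumes inp: "inp s" and seeded: "seeded s" and thr_quota: "thr s = quota"
    and quarter_optimal: "committee (current s)" "quarter_optimal (base s) (current s)"
    and minimum: "\<forall>t. t \<le> reals s ''mn'' 0 \<longleftrightarrow> t \<le> quota \<and> hall I t (current s)"
  shows "run balancer set_bracket s (8 * bal) (\<lambda>s'. bracketed s' \<and> up s' \<le> 2 * lo s')"
  (is "run balancer _ s _ ?Q")
  unfolding set_bracket_def
proof (rule run_Seq_RSet)
  let ?m = "reals s ''mn'' 0"
  let ?s1 = "rupd ''lo'' (nval (NConst 0) s) (rval (rvar ''mn'') s) s"
  let ?s2 = "rupd ''up'' 0 (min (2 * ?m) quota) ?s1"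
  let ?up = "Cond (RLess (RMul (rnum 2) (rvar ''lo'')) (rvar ''thr''))
           (rset ''up'' (RMul (rnum 2) (rvar ''lo''))) (rset ''up'' (rvar ''thr''))"
  have bracket: "bracket (base s) (current s) ?m (min (2 * ?m) quota)"
    using seeded quarter_optimal minimum by (intro bracket_initial) (auto simp: seeded_def)
  show "run balancer (Seq ?up (copy ''committee'' ''cur'')) ?s1 (7 * bal) ?Q"
  proof (rule run_Seq)
    show "run balancer ?up ?s1 2 (\<lambda>s2. s2 = ?s2)"
      using thr_quota by (intro run_Cond[where b = 1] run_RSet) (auto simp: min_def)
    fix s2 assume s2_eq: "s2 = ?s2"
    then have inp2: "inp s2" using inp by simp
    show "run balancer (copy ''committee'' ''cur'') s2 (5 * bal) ?Q"
    proof (rule run_mono[OF run_copy[OF inp2]])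
      fix s3 assume "incumbent s3 = current s2"
        and frame: "frame (copy ''committee'' ''cur'') s2 s3"
      then show "?Q s3"
        using bracket seeded frame_nats[OF frame] frame_reals[OF frame]
        by (simp add: s2_eq bracketed_def seeded_def)
    qed auto
  qed (use bal_ge_1 in auto)
qed (use bal_ge_1 in simp)

lemma run_find_bracket:
  assumes inp: "inp s" and seeded: "seeded s" "base s = current s" and thr_quota: "thr s = quota"
    and tracked: "tracked s"
  shows "run balancer find_bracket s (88 * (bal * real (length cs)))
    (\<lambda>s'. bracketed s' \<and> up s' \<le> 2 * lo s')"
  (is "run balancer _ s _ ?Q")
  unfolding find_bracket_def
proof (rule run_Seq_inp[OF inp run_greedy[OF inp tracked]])
  fix s1
  assume inp1: "inp s1" and frame1: "frame greedy s s1"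
    and greedy: "committee (current s1) \<and> quarter_optimal (current s) (current s1)"
  have unchanged1: "nats s1 ''base'' = nats s ''base''" "nats s1 ''bcnt'' = nats s ''bcnt''"
    "thr s1 = quota"
    using frame_nats[OF frame1] frame_reals[OF frame1] thr_quota by simp_all
  have card: "card (current s1) \<le> seats I" using greedy by (simp add: committee_def)
  show "run balancer (Seq evaluate set_bracket) s1 (27 * bal) ?Q"
  proof (rule run_Seq_inp[OF inp1 run_evaluate[OF inp1 card]])
    fix s2
    assume inp2: "inp s2" and frame2: "frame evaluate s1 s2"
      and minimum: "\<forall>t. t \<le> reals s2 ''mn'' 0 \<longleftrightarrow> t \<le> thr s1 \<and> hall I t (current s1)"
    have "nats s2 ''base'' = nats s ''base''" "nats s2 ''bcnt'' = nats s ''bcnt''" "thr s2 = quota"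
      "nats s2 ''cur'' = nats s1 ''cur''"
      using frame_nats[OF frame2] frame_reals[OF frame2] unchanged1 by simp_all
    then show "run balancer set_bracket s2 (8 * bal) ?Q"
      using seeded greedy minimum unchanged1(3)
      by (intro run_set_bracket[OF inp2]) (simp_all add: seeded_def)
  qed auto
qed (use bal_le_bal_mult_length_cs in auto)

lemma run_rescan:
  assumes inp: "inp s" and seeded: "seeded s" and thr_le: "thr s \<le> quota"
  shows "run balancer rescan s (33 * (bal * real (length cs)))
    (\<lambda>s'. tracked s' \<and> base s \<subseteq> current s' \<and> saturated (cands I) (thr s) (current s'))"
  (is "run balancer _ s _ ?Q")
  unfolding rescan_def
proof (rule run_Seq_inp[OF inp run_copy[OF inp]])
  fix s1
  assume inp1: "inp s1" and current1: "current s1 = base s"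
    and frame: "frame (copy ''cur'' ''base'') s s1"
  let ?s2 = "nupd ''cnt'' (nval (NConst 0) s1) (nval (nvar ''bcnt'') s1) s1"
  have inp2: "inp ?s2" using inp1 by simp
  have "hall I (thr s) (base s)"
    using seeded thr_le hall_antimono unfolding seeded_def saturated_def by blast
  then have hall: "hall I (thr ?s2) (current ?s2)"
    using frame_reals[OF frame] by (simp add: current1)
  have tracked: "tracked ?s2"
    using seeded frame_nats[OF frame] by (simp add: tracked_def current1 seeded_def saturated_def)
  have "run balancer scan ?s2 (27 * (bal * real (length cs))) ?Q"
    using frame_reals[OF frame]
    by (intro run_mono[OF run_scan[OF inp2 tracked hall]]) (auto simp: current1)
  then show "run balancer (Seq (nset ''cnt'' (nvar ''bcnt'')) scan) s1
    (28 * (bal * real (length cs))) ?Q"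
    by (rule run_Seq_NSet) (use bal_ge_1 bal_le_bal_mult_length_cs in linarith)
qed (use bal_le_bal_mult_length_cs in auto)

lemma run_narrow:
  assumes inp: "inp s" and bracketed: "bracketed s" and thr_bounds: "lo s \<le> thr s" "thr s \<le> up s"
    and tracked: "tracked s" and base_subset: "base s \<subseteq> current s"
    and saturated: "saturated (cands I) (thr s) (current s)"
  shows "run balancer narrow s (7 * bal)
    (\<lambda>s'. bracketed s' \<and> (lo s' = lo s \<and> up s' = thr s \<or> lo s' = thr s \<and> up s' = up s))"
  (is "run balancer _ s _ ?Q")
proof -
  have bracket: "bracket (base s) (incumbent s) (lo s) (up s)" and seeded: "seeded s"
    using bracketed by (simp_all add: bracketed_def)
  have below_iff: "bval below_seats s \<longleftrightarrow> card (current s) < seats I"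
    using tracked by (simp add: tracked_def inp_seats[OF inp])
  show ?thesis
    unfolding narrow_def
  proof (rule run_Cond[where b = "6 * bal"])
    assume "bval below_seats s"
    then have "bracket (base s) (incumbent s) (lo s) (thr s)"
      using bracket_lower[OF bracket thr_bounds saturated] below_iff by blast
    then show "run balancer (rset ''up'' (rvar ''thr'')) s (6 * bal) ?Q"
      using seeded bal_ge_1 by (intro run_RSet) (simp_all add: bracketed_def seeded_def)
  next
    assume "\<not> bval below_seats s"
    then have "card (current s) = seats I" using below_iff tracked by (simp add: tracked_def)
    then have raised: "bracket (base s) (current s) (thr s) (up s)"
      by (rule bracket_raise[OF bracket thr_bounds base_subset saturated])
    let ?s1 = "rupd ''lo'' (nval (NConst 0) s) (rval (rvar ''thr'') s) s"
    have "run balancer (copy ''committee'' ''cur'') ?s1 (5 * bal) ?Q"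
    proof (rule run_mono[OF run_copy])
      fix s2 assume "incumbent s2 = current ?s1"
        and frame: "frame (copy ''committee'' ''cur'') ?s1 s2"
      then show "?Q s2"
        using raised seeded frame_nats[OF frame] frame_reals[OF frame]
        by (simp add: bracketed_def seeded_def)
    qed (use inp in simp_all)
    then show "run balancer (Seq (rset ''lo'' (rvar ''thr'')) (copy ''committee'' ''cur'')) s
      (6 * bal) ?Q"
      by (rule run_Seq_RSet) (use bal_ge_1 in simp)
  qed (use bal_ge_1 in simp)
qed

lemma run_bisect:
  assumes inp: "inp s" and bracketed: "bracketed s"
  shows "run balancer bisect s (41 * (bal * real (length cs)))
    (\<lambda>s'. inp s' \<and> bracketed s' \<and> lo s \<le> lo s' \<and> up s' - lo s' = (up s - lo s) / 2)"
  (is "run balancer bisect s _ ?Q")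
  unfolding bisect_def
proof (rule run_Seq_RSet)
  define t where "t = (lo s + up s) / 2"
  have t_bounds: "lo s \<le> t" "t \<le> up s" "t \<le> quota"
    using bracketed by (auto simp: bracketed_def bracket_def t_def)
  let ?s1 = "rupd ''thr'' (nval (NConst 0) s)
    (rval (RDiv (RAdd (rvar ''lo'') (rvar ''up'')) (rnum 2)) s) s"
  have ready1: "inp ?s1" "seeded ?s1" "thr ?s1 = t"
    using inp bracketed by (simp_all add: bracketed_def seeded_def t_def)
  have rescan: "run balancer rescan ?s1 (33 * (bal * real (length cs)))
    (\<lambda>s'. tracked s' \<and> base ?s1 \<subseteq> current s' \<and> saturated (cands I) (thr ?s1) (current s'))"
    using ready1 t_bounds by (intro run_rescan) auto
  show "run balancer (Seq rescan narrow) ?s1 (40 * (bal * real (length cs))) ?Q"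
  proof (rule run_Seq_inp[OF ready1(1) rescan])
    fix s2
    assume inp2: "inp s2" and frame2: "frame rescan ?s1 s2"
      and scanned: "tracked s2 \<and> base ?s1 \<subseteq> current s2 \<and> saturated (cands I) (thr ?s1) (current s2)"
    have unchanged: "nats s2 ''base'' = nats s ''base''" "nats s2 ''bcnt'' = nats s ''bcnt''"
      "nats s2 ''committee'' = nats s ''committee''" "lo s2 = lo s" "up s2 = up s" "thr s2 = t"
      using frame_nats[OF frame2] frame_reals[OF frame2] ready1(3) by simp_all
    have bracketed2: "bracketed s2"
      using bracketed by (simp add: bracketed_def seeded_def unchanged)
    show "run balancer narrow s2 (7 * (bal * real (length cs))) ?Q"
    proof (rule run_mono[OF run_narrow[OF inp2 bracketed2]])
      fix s3 assume "bracketed s3 \<and>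
        (lo s3 = lo s2 \<and> up s3 = thr s2 \<or> lo s3 = thr s2 \<and> up s3 = up s2)"
        and frame3: "frame narrow s2 s3"
      moreover have "inp s3" by (rule inp_frame[OF inp2 frame3]) (simp add: narrow_def)
      ultimately show "?Q s3" using t_bounds(1) by (auto simp: unchanged t_def field_simps)
    qed (use t_bounds scanned ready1(3) bal_le_bal_mult_length_cs in \<open>auto simp: unchanged\<close>)
  qed auto
qed (use bal_ge_1 bal_le_bal_mult_length_cs in linarith)

lemma run_bisection:
  assumes inp: "inp s" and bracketed: "bracketed s" and up_le: "up s \<le> 2 * lo s"
    and rounds: "2 \<le> \<epsilon> * 2 ^ n"
  shows "run balancer (While unfinished bisect) s (1 + real n * (41 * (bal * real (length cs)) + 1))
    (\<lambda>s'. bracketed s' \<and> 2 * up s' \<le> lo s' * (2 + \<epsilon>))"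
proof -
  let ?Inv = "\<lambda>k s'. inp s' \<and> bracketed s' \<and> lo s \<le> lo s' \<and> up s' - lo s' \<le> \<epsilon> / 2 * lo s * 2 ^ k"
  have unfinished_iff: "bval unfinished s' \<longleftrightarrow> \<epsilon> * lo s' < 2 * (up s' - lo s')" if "inp s'" for s'
    using inp_eps[OF that] by (simp add: unfinished_def algebra_simps)
  have init: "?Inv n s"
  proof (intro conjI inp bracketed order_refl)
    have "up s - lo s \<le> lo s" using up_le by simp
    also have "\<dots> \<le> \<epsilon> / 2 * lo s * 2 ^ n"
      using mult_right_mono[OF rounds, of "lo s"] bracketed
      by (simp add: bracketed_def bracket_def mult_ac)
    finally show "up s - lo s \<le> \<epsilon> / 2 * lo s * 2 ^ n" .
  qed
  have step: "0 < k \<and> run balancer bisect s' (41 * (bal * real (length cs))) (?Inv (k - 1))"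
    if invariant: "?Inv k s'" and test: "bval unfinished s'" for k s'
  proof -
    have "\<epsilon> * lo s < 2 * (up s' - lo s')"
      using mult_left_mono[of "lo s" "lo s'" \<epsilon>] unfinished_iff[of s'] invariant test eps_pos
      by linarith
    then obtain j where k_Suc: "k = Suc j" using invariant by (cases k) auto
    have "run balancer bisect s' (41 * (bal * real (length cs))) (?Inv (k - 1))"
      by (rule run_mono[OF run_bisect]) (use invariant k_Suc in auto)
    then show ?thesis by (simp add: k_Suc)
  qed
  show ?thesis
  proof (rule run_mono[OF run_While[where Inv = ?Inv, OF step _ init]])
    fix s' assume "\<not> bval unfinished s' \<and> (\<exists>k. ?Inv k s')"
    then show "bracketed s' \<and> 2 * up s' \<le> lo s' * (2 + \<epsilon>)"
      using unfinished_iff by (auto simp: algebra_simps)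
  qed (use bal_ge_1 in auto)
qed

lemma run_output:
  assumes bracketed: "bracketed s" and gap: "2 * up s \<le> lo s * (2 + \<epsilon>)"
  shows "run balancer (Call ''committee'' ''weight'') s bal (\<lambda>s'. \<exists>A w.
    output_store cs es A w s' \<and> approximation (2 + \<epsilon>) I A w \<and>
    (0 < (\<Sum>n\<in>voters I. strength I n) \<longrightarrow> PJR I A))"
proof -
  define A where "A = incumbent s"
  have bracket: "bracket (base s) A (lo s) (up s)"
    using bracketed by (simp add: bracketed_def A_def)
  then have A_committee: "A \<subseteq> cands I" "card A \<le> seats I" by (auto simp: bracket_def committee_def)
  have "approximation (2 + \<epsilon>) I A (solve A)"
    using bracket_approximation[OF bracket solve_balanced[OF A_committee] eps_pos gap] .
  moreover have "0 < (\<Sum>n\<in>voters I. strength I n) \<longrightarrow> PJR I A"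
    using bracket_PJR[OF bracket] by blast
  moreover have "output_store cs es A (solve A)
      (s\<lparr>reals := (reals s)(''weight'' := fst (balancer (nats s ''committee'')))\<rparr>)"
    by (simp add: output_store_def subroutine_def Let_def A_def)
  moreover have "real (snd (balancer (nats s ''committee''))) \<le> bal"
    using time_le[OF A_committee] by (simp add: subroutine_def Let_def A_def)
  ultimately show ?thesis by (intro run_Call) blast+
qed

lemma run_lazy_mms:
  assumes inp: "inp s" and rounds: "2 \<le> \<epsilon> * 2 ^ n"
  shows "run balancer lazy_mms s ((136 + 42 * real n) * (bal * real (length cs))) (\<lambda>s'. \<exists>A w.
    output_store cs es A w s' \<and> approximation (2 + \<epsilon>) I A w \<and>
    (0 < (\<Sum>n\<in>voters I. strength I n) \<longrightarrow> PJR I A))" (is "run balancer _ s _ ?Q")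
proof -
  let ?b = "bal * real (length cs)"
  let ?loop = "1 + real n * (41 * ?b + 1)"
  let ?search = "Seq (While unfinished bisect) (Call ''committee'' ''weight'')"
  have bal_bounds: "1 \<le> ?b" "bal \<le> ?b" using bal_ge_1 bal_le_bal_mult_length_cs by linarith+
  have "?loop + bal \<le> 1 + real n * (42 * ?b) + bal"
    using bal_bounds by (intro add_mono mult_left_mono) auto
  then have time: "?loop + bal \<le> (2 + 42 * real n) * ?b"
    using bal_bounds by (simp add: algebra_simps)
  have search: "run balancer ?search s3 (?loop + bal) ?Q"
    if "inp s3" "bracketed s3 \<and> up s3 \<le> 2 * lo s3" for s3
    using that rounds run_output by (intro run_Seq[OF run_bisection]) auto
  have start: "run balancer (Seq find_bracket ?search) s2 (88 * ?b + (?loop + bal)) ?Q"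
    if "inp s2" "seeded s2 \<and> thr s2 = quota \<and> base s2 = current s2 \<and> tracked s2" for s2
    using that search
    by (intro run_Seq_inp[OF that(1) run_find_bracket])
      (auto simp: find_bracket_def set_bracket_def)
  have seed: "run balancer (Seq seed (Seq find_bracket ?search)) s1
    (39 * ?b + (88 * ?b + (?loop + bal))) ?Q"
    if "inp s1" "thr s1 = quota" for s1
    using that start by (intro run_Seq_inp[OF that(1) run_seed]) (auto simp: seed_def clear_def)
  have "run balancer lazy_mms s (7 * bal + (39 * ?b + (88 * ?b + (?loop + bal)))) ?Q"
    unfolding lazy_mms_def using seed
    by (intro run_Seq_inp[OF inp run_set_quota[OF inp]]) (auto simp: set_quota_def)
  then show ?thesis
    using time bal_bounds by (elim run_mono) (auto simp: algebra_simps)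
qed

lemma run_lazy_mms_log:
  assumes inp: "inp s"
  shows "run balancer lazy_mms s (262 * log 2 (1 / min \<epsilon> (1 / 2)) * (bal * real (length cs)))
    (\<lambda>s'. \<exists>A w. output_store cs es A w s' \<and> approximation (2 + \<epsilon>) I A w \<and>
      (0 < (\<Sum>n\<in>voters I. strength I n) \<longrightarrow> PJR I A))"
proof -
  define e where "e = min \<epsilon> (1 / 2)"
  have e_bounds: "0 < e" "e \<le> 1 / 2" "e \<le> \<epsilon>" using eps_pos by (auto simp: e_def)
  have log_ge: "1 \<le> log 2 (1 / e)" using e_bounds by (subst le_log_iff) (auto simp: field_simps)
  obtain n where n_bounds: "2 / e \<le> 2 ^ n" "real n \<le> log 2 (2 / e) + 1"
    using exists_power_two_ge[of "2 / e"] e_bounds by auto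
  have "2 \<le> e * 2 ^ n" using n_bounds(1) e_bounds by (simp add: field_simps)
  also have "\<dots> \<le> \<epsilon> * 2 ^ n" using e_bounds by simp
  finally have rounds: "2 \<le> \<epsilon> * 2 ^ n" .
  have "log 2 (2 / e) = log 2 (1 / e) + 1"
    using e_bounds log_mult[of 2 "1 / e" 2] by simp
  then have "136 + 42 * real n \<le> 262 * log 2 (1 / e)" using n_bounds(2) log_ge by simp
  then show ?thesis
    using bal_ge_1 unfolding e_def
    by (intro run_mono[OF run_lazy_mms[OF inp rounds]] mult_right_mono) auto
qed

end

theorem theorem5:
  "\<exists>(p :: prog) (K :: real).
     \<forall>(I :: (nat, nat) election) vs cs es (\<epsilon> :: real) solve time bal s.
       election_instance I \<longrightarrow>
       enumerates I vs cs es \<longrightarrow>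
       0 < \<epsilon> \<longrightarrow>
       balancing_procedure I solve time bal \<longrightarrow>
       input_store I vs cs es \<epsilon> s \<longrightarrow>
       (\<exists>t s' A w.
          exec (subroutine cs es solve time) p s t s' \<and>
          output_store cs es A w s' \<and>
          approximation (2 + \<epsilon>) I A w \<and>
          (0 < (\<Sum>n\<in>voters I. strength I n) \<longrightarrow> PJR I A) \<and>
          real t \<le> K * (bal * real (card (cands I)) * ln (1 / min \<epsilon> (1 / 2))))"
proof (rule exI[of _ lazy_mms], rule exI[of _ "262 / ln 2"], intro allI impI)
  fix I :: "(nat, nat) election" and vs cs es and \<epsilon> :: real and solve time bal s
  assume "election_instance I" "enumerates I vs cs es" "0 < \<epsilon>"
    and "balancing_procedure I solve time bal" and inp: "input_store I vs cs es \<epsilon> s"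
  then interpret machine I vs cs es \<epsilon> solve time bal by unfold_locales
  have "262 * log 2 (1 / min \<epsilon> (1 / 2)) * (bal * real (length cs))
      = 262 / ln 2 * (bal * real (card (cands I)) * ln (1 / min \<epsilon> (1 / 2)))"
    by (simp add: log_def length_cs)
  then show "\<exists>t s' A w.
      exec (subroutine cs es solve time) lazy_mms s t s' \<and>
      output_store cs es A w s' \<and>
      approximation (2 + \<epsilon>) I A w \<and>
      (0 < (\<Sum>n\<in>voters I. strength I n) \<longrightarrow> PJR I A) \<and>
      real t \<le> 262 / ln 2 * (bal * real (card (cands I)) * ln (1 / min \<epsilon> (1 / 2)))"
    using run_lazy_mms_log[OF inp] unfolding run_def by metis
qed

end
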